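(* Assume the setting of the context. Let $r,s$ be positive integers with $s\ge N$ and $r\ge sL$. Then for every $e\in E(\alpha^-,s)$ and every $f\in F(\alpha^+_{r+1},s)$ there exists $\beta$ with $0<\beta<1$ such that $$\mathcal M_+(\alpha,\beta)=\frac{e\,f\,D^+_r}{1-\alpha^-\alpha^+}.$$
   Context: $\|x\|$ is the distance to the nearest integer, $\mathcal M_+(\alpha,\beta)=\liminf_{q\to\infty}q\|q\alpha-\beta\|$ over positive integers $q$. For irrational $\gamma\in(0,1)$: negative continued fraction $\gamma_1=\gamma$, $g_i=\lceil1/\gamma_i\rceil$, $\gamma_{i+1}=g_i-1/\gamma_i$; $D_0(\gamma)=1$, $D_i(\gamma)=\gamma_1\cdots\gamma_i$; Davenport coefficients of $x\in[0,1)$ w.r.t. $\gamma$: $x_1=x$, $b_i=\lfloor x_i/\gamma_i\rfloor$, $x_{i+1}=x_i/\gamma_i-b_i$, so $x=\sum b_kD_k(\gamma)$. $F(\gamma,s)$ is the set of $x\in[0,1)$ whose Davenport coefficients $(b_i)$ w.r.t. $\gamma$ contain no block $b_i,\dots,b_{i+s}$ consisting only of zeros and no block $b_i,\dots,b_{i+s}$ equal to $g_i-1,g_{i+1}-2,\dots,g_{i+s}-2$. $E(\gamma,s)$ is the set of $x\in[0,1]$ admitting a representation $x=\sum b_kD_k(\gamma)$, where $(b_k)$ is either the Davenport coefficient sequence of $x$ or a sequence of the form $b_1,\dots,b_m,g_{m+1}-1,g_{m+2}-2,g_{m+3}-2,\dots$ obtained from it by replacing a final segment $c,0,0,\dots$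 at position $m$ by $c-1,g_{m+1}-1,g_{m+2}-2,\dots$ (these have the same sum), such that $(b_k)$ contains no block $b_i,\dots,b_{i+s}$ consisting only of zeros and no block $b_i,\dots,b_{i+s}$ equal to $g_i-2,g_{i+1}-2,\dots,g_{i+s-1}-2,g_{i+s}-1$. Setting: $\alpha\in(0,1)$ is irrational with negative partial quotients $(a_i)$ bounded, $M=\sup a_i$, and $N-1\ge0$ the least upper bound of lengths of blocks of consecutive $2$'s in $(a_i)$. $R=N/(N+1)$, $L$ the smallest integer with $R^L\le(1-R)(1-R^2)/(M^N(M^2-1))$. $(K(i))$ is an increasing sequence with $K(i+1)-K(i)\to\infty$ such that $a^-_j=\lim_ia_{K(i)-j+1}$ and $a^+_j=\lim_ia_{K(i)+j}$ exist for all $j\ge1$; $\alpha^\pm_j=\langle a^\pm_j,a^\pm_{j+1},\dots\rangle$ where $\langle x_1,x_2,\dots\rangle=1/(x_1-1/(x_2-\cdots))$; $\alpha^\pm=\alpha^\pm_1$; $D^+_r=\alpha^+_1\cdots\alpha^+_r$. *)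

theory Defs
  imports Complex_Main "HOL-Library.Extended_Real"
begin

text \<open>All sequences are indexed from 1; entry 0 of a function on \<^typ>\<open>nat\<close> is an unused dummy
  (except for \<open>ncf_D \<gamma> 0 = 1\<close>).\<close>

definition dist_nearest_int :: "real \<Rightarrow> real" where
  "dist_nearest_int x = \<bar>x - of_int (round x)\<bar>"

definition M_plus :: "real \<Rightarrow> real \<Rightarrow> ereal" where
  "M_plus \<alpha> \<beta> = liminf (\<lambda>q::nat. ereal (real q * dist_nearest_int (real q * \<alpha> - \<beta>)))"

fun ncf_rem :: "real \<Rightarrow> nat \<Rightarrow> real" where
  "ncf_rem \<gamma> 0 = \<gamma>"
| "ncf_rem \<gamma> (Suc 0) = \<gamma>"
| "ncf_rem \<gamma> (Suc (Suc i)) =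
     of_int \<lceil>1 / ncf_rem \<gamma> (Suc i)\<rceil> - 1 / ncf_rem \<gamma> (Suc i)"

definition ncf_digit :: "real \<Rightarrow> nat \<Rightarrow> int" where
  "ncf_digit \<gamma> i = \<lceil>1 / ncf_rem \<gamma> i\<rceil>"

definition ncf_D :: "real \<Rightarrow> nat \<Rightarrow> real" where
  "ncf_D \<gamma> i = (\<Prod>k=1..i. ncf_rem \<gamma> k)"

fun dav_rem :: "real \<Rightarrow> real \<Rightarrow> nat \<Rightarrow> real" where
  "dav_rem \<gamma> x 0 = x"
| "dav_rem \<gamma> x (Suc 0) = x"
| "dav_rem \<gamma> x (Suc (Suc i)) =
     dav_rem \<gamma> x (Suc i) / ncf_rem \<gamma> (Suc i)
       - of_int \<lfloor>dav_rem \<gamma> x (Suc i) / ncf_rem \<gamma> (Suc i)\<rfloor>"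

definition dav_coeff :: "real \<Rightarrow> real \<Rightarrow> nat \<Rightarrow> int" where
  "dav_coeff \<gamma> x i = \<lfloor>dav_rem \<gamma> x i / ncf_rem \<gamma> i\<rfloor>"

definition F_set :: "real \<Rightarrow> nat \<Rightarrow> real set" where
  "F_set \<gamma> s = {x. 0 \<le> x \<and> x < 1 \<and>
     \<not> (\<exists>i\<ge>1. \<forall>j\<le>s. dav_coeff \<gamma> x (i + j) = 0) \<and>
     \<not> (\<exists>i\<ge>1. dav_coeff \<gamma> x i = ncf_digit \<gamma> i - 1 \<and>
          (\<forall>j\<in>{1..s}. dav_coeff \<gamma> x (i + j) = ncf_digit \<gamma> (i + j) - 2))}"

definition replace_tail :: "real \<Rightarrow> nat \<Rightarrow> (nat \<Rightarrow> int) \<Rightarrow> nat \<Rightarrow> int" where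
  "replace_tail \<gamma> m b k =
     (if k < m then b k
      else if k = m then b m - 1
      else if k = m + 1 then ncf_digit \<gamma> k - 1
      else ncf_digit \<gamma> k - 2)"

text \<open>The admissible coefficient sequences of a point \<open>x\<close> of \<open>[0,1]\<close>. Davenport coefficients
  are only defined on \<open>[0,1)\<close>. The last alternative is the endpoint \<open>x = 1\<close>: it is the case
  \<open>m = 0\<close>, where \<open>1 = 1 \<cdot> D\<^sub>0\<close> is rewritten as \<open>g\<^sub>1 - 1, g\<^sub>2 - 2, g\<^sub>3 - 2, \<dots>\<close>. (Running the
  Davenport algorithm on \<open>x = 1\<close> produces the same sequence.)\<close>

definition E_repr :: "real \<Rightarrow> real \<Rightarrow> (nat \<Rightarrow> int) \<Rightarrow> bool" where
  "E_repr \<gamma> x b \<longleftrightarrow>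
     (0 \<le> x \<and> x < 1 \<and> b = dav_coeff \<gamma> x) \<or>
     (0 \<le> x \<and> x < 1 \<and>
        (\<exists>m\<ge>1. dav_coeff \<gamma> x m \<ge> 1 \<and> (\<forall>k>m. dav_coeff \<gamma> x k = 0) \<and>
               b = replace_tail \<gamma> m (dav_coeff \<gamma> x))) \<or>
     (x = 1 \<and> b = replace_tail \<gamma> 0 (\<lambda>k. if k = 0 then 1 else 0))"

definition E_set :: "real \<Rightarrow> nat \<Rightarrow> real set" where
  "E_set \<gamma> s = {x. 0 \<le> x \<and> x \<le> 1 \<and>
     (\<exists>b. E_repr \<gamma> x b \<and>
          (\<lambda>k. of_int (b (Suc k)) * ncf_D \<gamma> (Suc k)) sums x \<and>
          \<not> (\<exists>i\<ge>1. \<forall>j\<le>s. b (i + j) = 0) \<and>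
          \<not> (\<exists>i\<ge>1. (\<forall>j<s. b (i + j) = ncf_digit \<gamma> (i + j) - 2) \<and>
                     b (i + s) = ncf_digit \<gamma> (i + s) - 1))}"

text \<open>\<open>ncf_trunc x n j\<close> is the truncation \<open>1/(x\<^sub>j - 1/(x\<^sub>j\<^sub>+\<^sub>1 - \<dots> - 1/x\<^sub>j\<^sub>+\<^sub>n\<^sub>-\<^sub>1))\<close> with \<open>n\<close> partial
  quotients, and \<open>ncf_value x j\<close> is \<open>\<langle>x\<^sub>j, x\<^sub>j\<^sub>+\<^sub>1, \<dots>\<rangle>\<close>.\<close>

primrec ncf_trunc :: "(nat \<Rightarrow> int) \<Rightarrow> nat \<Rightarrow> nat \<Rightarrow> real" where
  "ncf_trunc x 0 j = 0"
| "ncf_trunc x (Suc n) j = 1 / (of_int (x j) - ncf_trunc x n (Suc j))"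

definition ncf_value :: "(nat \<Rightarrow> int) \<Rightarrow> nat \<Rightarrow> real" where
  "ncf_value x j = lim (\<lambda>n. ncf_trunc x n j)"

definition two_block_lengths :: "(nat \<Rightarrow> int) \<Rightarrow> nat set" where
  "two_block_lengths a = {l. \<exists>i\<ge>1. \<forall>j<l. a (i + j) = 2}"

end

theory Submission
  imports Defs "HOL-Analysis.Uniform_Limit"
begin

text \<open>Let \<open>Q\<^sub>n\<close> be the denominators of the convergents of \<open>\<alpha>\<close>, so that \<open>D\<^sub>n\<close> is congruent to \<open>Q\<^sub>n \<alpha>\<close> modulo 1.
  For \<open>\<beta> = \<Sum> b\<^sub>k D\<^sub>k\<close> with tails \<open>T\<^sub>n = \<Sum>\<^sub>k\<^sub>>\<^sub>n b\<^sub>k D\<^sub>k\<close>, the integers \<open>N\<^sub>n = \<Sum>\<^sub>k\<^sub>\<le>\<^sub>n b\<^sub>k Q\<^sub>k\<close> (\<open>Nq n\<close> below) satisfy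
  \<open>N\<^sub>n \<alpha> - \<beta> = - T\<^sub>n\<close> and \<open>(N\<^sub>n + Q\<^sub>n) \<alpha> - \<beta> = D\<^sub>n - T\<^sub>n\<close> modulo 1. The points \<open>(N\<^sub>n, T\<^sub>n)\<close> are the vertices of a
  polygonal line below which there is no point \<open>(q, \<bar>q \<alpha> - p - \<beta>\<bar>)\<close> with \<open>q \<alpha> - p < \<beta>\<close>, and the points
  \<open>(N\<^sub>n + Q\<^sub>n, D\<^sub>n - T\<^sub>n)\<close> play the same role for \<open>q \<alpha> - p \<ge> \<beta>\<close>. The product of the coordinates attains its
  minimum on a segment at an end point, so \<open>M_plus\<close> is governed by the products \<open>N\<^sub>n T\<^sub>n\<close> and
  \<open>(N\<^sub>n + Q\<^sub>n) (D\<^sub>n - T\<^sub>n)\<close>.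

  The digits of \<open>\<beta>\<close> contain, around sparse positions \<open>\<kappa>\<close> from the sequence \<open>K\<close>, the digits of \<open>e\<close> in reversed
  order, then \<open>r\<close> zeros, then the digits of \<open>f\<close>. There \<open>N\<^sub>\<kappa> / Q\<^bsub>\<kappa>+1\<^esub>\<close> tends to \<open>e\<close>, the tail \<open>T\<^sub>\<kappa>\<close> is
  asymptotically \<open>D\<^sub>\<kappa> D\<^sup>+\<^sub>r f\<close>, and \<open>Q\<^bsub>\<kappa>+1\<^esub> D\<^sub>\<kappa>\<close> tends to \<open>1 / (1 - \<alpha>\<^sup>- \<alpha>\<^sup>+)\<close>. All other products are larger: the digits
  have neither long zero runs nor long maximal blocks away from the \<open>r\<close> zeros, and \<open>r \<ge> s L\<close> makes the
  limit at most \<open>R\<^sup>r / (1 - R\<^sup>2)\<close>, hence smaller than the resulting bound.\<close>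

section \<open>Negative continued fractions with bounded digits\<close>

lemma ncf_step_lower:
  fixes x u M :: real
  assumes "2 \<le> x" "x \<le> M" "0 \<le> u" "u < 1"
  shows "1 / M \<le> 1 / (x - u)" "0 < 1 / (x - u)" "1 / (x - u) < 1"
  using assms by (auto simp: divide_simps)

text \<open>A digit at least 3 gives at most 1/2 whatever follows, so it resets a bound of the form
  \<open>k / (k + 1)\<close>.\<close>

lemma ncf_step_three:
  fixes x u k :: real
  assumes "3 \<le> x" "u \<le> 1" "1 \<le> k"
  shows "1 / (x - u) \<le> k / (k + 1)"
proof -
  have "1 / (x - u) \<le> 1 / 2"
    using assms by (intro divide_left_mono) auto
  also have "1 / 2 \<le> k / (k + 1)"
    using assms by (simp add: divide_simps)
  finally show ?thesis .
qed

text \<open>\<open>k / (k + 1)\<close> is the value of the finite fraction with k digits 2. The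
  worst possible digit, a 2, moves this bound one step further.\<close>

lemma ncf_step_two:
  fixes x u k :: real
  assumes "2 \<le> x" "u \<le> k / (k + 1)" "0 \<le> k"
  shows "1 / (x - u) \<le> (k + 1) / (k + 2)"
proof -
  have *: "(k + 2) / (k + 1) \<le> x - u"
  proof -
    have "(k + 2) / (k + 1) = 2 - k / (k + 1)"
      using assms by (simp add: field_simps)
    then show ?thesis using assms by linarith
  qed
  have "0 < (k + 2) / (k + 1)" using assms by simp
  then have "1 / (x - u) \<le> 1 / ((k + 2) / (k + 1))"
    using * by (intro divide_left_mono mult_pos_pos) auto
  then show ?thesis by simp
qed

text \<open>\<open>y - z\<close> equals \<open>(u - w) * y * z\<close>, so one step of the recursion
  contracts by the square of a bound for the values.\<close>

lemma ncf_step_contraction: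
  fixes x y z u w R :: real
  assumes "y = 1 / (x - u)" "z = 1 / (x - w)" "u < x" "w < x" "y \<le> R" "z \<le> R"
  shows "\<bar>y - z\<bar> \<le> R\<^sup>2 * \<bar>u - w\<bar>"
proof -
  have pos: "0 < y" "0 < z" using assms by auto
  have "(x - u) * y = 1" "(x - w) * z = 1" using assms by auto
  then have "y - z = (u - w) * (y * z)" by algebra
  then have "\<bar>y - z\<bar> = \<bar>u - w\<bar> * (y * z)"
    using pos by (simp add: abs_mult)
  also have "\<dots> \<le> \<bar>u - w\<bar> * (R * R)"
    using pos assms(5,6) by (intro mult_left_mono mult_mono) (auto intro: order_trans)
  finally show ?thesis by (simp add: power2_eq_square mult.commute)
qed

text \<open>Meant for solutions of the recursion that are not yet known to be limits of truncations.
  A digit at least 3 resets the bound, and fewer than k digits precede it.\<close>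

lemma ncf_iterate_bound:
  fixes h :: "nat \<Rightarrow> real" and x :: "nat \<Rightarrow> int" and k n :: nat
  assumes step: "\<And>i. i < n \<Longrightarrow> h i = 1 / (x (j + i) - h (Suc i))"
    and digit: "\<And>i. i < n \<Longrightarrow> 2 \<le> x (j + i)"
    and last: "0 \<le> h n" "h n < 1"
    and three: "k \<le> n" "\<exists>i<k. 3 \<le> x (j + i)"
  shows "h 0 \<le> real k / (real k + 1)"
proof -
  have range: "0 \<le> h i \<and> h i < 1" if "i \<le> n" for i
    using that
  proof (induction i rule: inc_induct)
    case base
    then show ?case using last by simp
  next
    case (step i)
    have "2 \<le> real_of_int (x (j + i))" using digit[of i] step by simp
    then show ?case
      using assms(1)[of i] step ncf_step_lower[of "x (j + i)" "x (j + i)" "h (Suc i)"] by simp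
  qed
  \<comment> \<open>The induction on \<open>k - m\<close> moves the start m back through the window;
    each digit 2 worsens the bound by one step.\<close>
  have "m \<le> k \<Longrightarrow> \<exists>i<k. m \<le> i \<and> 3 \<le> x (j + i) \<Longrightarrow> h m \<le> (real k - m) / (real k - m + 1)" for m
  proof (induction "k - m" arbitrary: m)
    case 0
    then show ?case by auto
  next
    case (Suc d)
    then have mk: "m < k" by auto
    then have h: "h m = 1 / (x (j + m) - h (Suc m))" using step three by simp
    have le1: "h (Suc m) \<le> 1" using range[of "Suc m"] mk three by simp
    show ?case
    proof (cases "3 \<le> x (j + m)")
      case True
      then show ?thesis unfolding h using mk le1 by (intro ncf_step_three) auto
    next
      case False
      then obtain i where i: "i < k" "m \<le> i" "3 \<le> x (j + i)" using Suc by auto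
      then have "i \<noteq> m" using False by auto
      then have "h (Suc m) \<le> (real k - Suc m) / (real k - Suc m + 1)"
        using i Suc by (intro Suc.hyps) (auto intro!: exI[of _ i])
      then have "1 / (x (j + m) - h (Suc m)) \<le> ((real k - Suc m) + 1) / ((real k - Suc m) + 2)"
        using digit[of m] mk three by (intro ncf_step_two) auto
      then show ?thesis unfolding h using mk by (simp add: add.commute)
    qed
  qed
  from this[of 0] three show ?thesis by auto
qed

locale bounded_ncf =
  fixes x :: "nat \<Rightarrow> int" and M :: int and N :: nat
  assumes digit_ge: "1 \<le> j \<Longrightarrow> 2 \<le> x j"
    and digit_le: "1 \<le> j \<Longrightarrow> x j \<le> M"
    and no_twos: "1 \<le> j \<Longrightarrow> \<exists>i<N. 3 \<le> x (j + i)"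
begin

text \<open>The value of N digits 2 in a row. It bounds every tail, since one of any N consecutive
  digits is at least 3.\<close>

definition R :: real where "R = real N / (real N + 1)"

abbreviation v :: "nat \<Rightarrow> real" where "v \<equiv> ncf_value x"

lemma N_pos: "1 \<le> N"
  using no_twos[of 1] by auto

lemma M_ge: "3 \<le> M"
proof -
  obtain i where "3 \<le> x (1 + i)" using no_twos[of 1] by auto
  then show ?thesis using digit_le[of "1 + i"] by simp
qed

lemma R_bounds: "1 / 2 \<le> R" "R < 1" "0 < R"
  using N_pos by (auto simp: R_def divide_simps)

lemma trunc_range: "1 \<le> j \<Longrightarrow> 0 \<le> ncf_trunc x n j \<and> ncf_trunc x n j < 1"
proof (induction n arbitrary: j)
  case (Suc n)
  have "2 \<le> real_of_int (x j)" using digit_ge[OF Suc.prems] by linarith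
  then show ?case
    using Suc.IH[of "Suc j"] ncf_step_lower[of "x j" "x j" "ncf_trunc x n (Suc j)"] by simp
qed simp

text \<open>The end of a truncation resets the bound as a digit at least 3 does, because the empty
  truncation is 0; hence the alternative \<open>n < k\<close>.\<close>

lemma trunc_bound:
  fixes k :: nat
  shows "1 \<le> j \<Longrightarrow> n < k \<or> (\<exists>i<k. 3 \<le> x (j + i)) \<Longrightarrow> ncf_trunc x n j \<le> k / (k + 1)"
proof (induction n arbitrary: j k)
  case (Suc n)
  have r: "ncf_trunc x n (Suc j) \<le> 1" using trunc_range[of "Suc j" n] by simp
  show ?case
  proof (cases "3 \<le> x j")
    case True
    then show ?thesis using r Suc.prems ncf_step_three[of "x j" "ncf_trunc x n (Suc j)" k]
      by (auto simp: add.commute)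
  next
    case False
    obtain l where k: "k = Suc l" using Suc.prems by (cases k) auto
    have "n < l \<or> (\<exists>i<l. 3 \<le> x (Suc j + i))"
      using Suc.prems(2)
    proof
      assume "\<exists>i<k. 3 \<le> x (j + i)"
      then obtain i where i: "i < k" "3 \<le> x (j + i)" by auto
      with False obtain i' where "i = Suc i'" by (cases i) auto
      with i k show ?thesis by auto
    qed (use k in auto)
    then have "ncf_trunc x n (Suc j) \<le> l / (l + 1)"
      using Suc.prems by (intro Suc.IH) auto
    moreover have "2 \<le> real_of_int (x j)" using digit_ge[OF Suc.prems(1)] by linarith
    ultimately show ?thesis using k ncf_step_two[of "x j" "ncf_trunc x n (Suc j)" l]
      by (simp add: add.commute)
  qed
qed simp

lemma trunc_le_R: "1 \<le> j \<Longrightarrow> ncf_trunc x n j \<le> R"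
  using trunc_bound[of j n N] no_twos[of j] unfolding R_def by (auto simp: add.commute)

text \<open>Any solution of the recursion over a window of the digits, such as a remainder sequence or
  a reversed ratio of continuants, is determined up to an exponentially small error.\<close>

lemma window_approx:
  fixes h :: "nat \<Rightarrow> real"
  assumes "\<And>i. i < n \<Longrightarrow> h i = 1 / (x (j + i) - h (Suc i))"
    and "\<And>i. i \<le> n \<Longrightarrow> 0 \<le> h i \<and> h i \<le> R" and "1 \<le> j"
  shows "\<bar>h 0 - ncf_trunc x n j\<bar> \<le> R ^ (2 * n)"
  using assms
proof (induction n arbitrary: h j)
  case 0
  then show ?case using R_bounds by (auto simp: abs_if intro: order_trans)
next
  case (Suc n)
  have IH: "\<bar>h (Suc 0) - ncf_trunc x n (Suc j)\<bar> \<le> R ^ (2 * n)"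
    using Suc.prems Suc.prems(1)[of "Suc _"] Suc.prems(2)[of "Suc _"]
    by (intro Suc.IH[of "\<lambda>i. h (Suc i)" "Suc j"]) auto
  have x: "2 \<le> real_of_int (x j)" using digit_ge[OF Suc.prems(3)] by linarith
  have "\<bar>h 0 - ncf_trunc x (Suc n) j\<bar> \<le> R\<^sup>2 * \<bar>h (Suc 0) - ncf_trunc x n (Suc j)\<bar>"
    using Suc.prems(1)[of 0] Suc.prems(2)[of 0] Suc.prems(2)[of "Suc 0"] x R_bounds
      trunc_le_R[of j "Suc n"] trunc_le_R[of "Suc j" n] Suc.prems(3)
    by (intro ncf_step_contraction) auto
  also have "\<dots> \<le> R\<^sup>2 * R ^ (2 * n)" using IH by (intro mult_left_mono) auto
  also have "\<dots> = R ^ (2 * Suc n)" by (simp add: power_add power2_eq_square)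
  finally show ?case .
qed

lemma trunc_approx:
  assumes "1 \<le> j" "n \<le> m"
  shows "\<bar>ncf_trunc x m j - ncf_trunc x n j\<bar> \<le> R ^ (2 * n)"
\<comment> \<open>The longer truncation solves the recursion itself: at position
  \<open>j + i\<close> it has \<open>m - i\<close> quotients left.\<close>
proof (rule window_approx[of n "\<lambda>i. ncf_trunc x (m - i) (j + i)" j, simplified])
  fix i assume "i < n"
  then obtain d where "m - i = Suc d" "m - Suc i = d" using assms
    by (metis Suc_diff_Suc less_le_trans)
  then show "ncf_trunc x (m - i) (j + i) =
      1 / (real_of_int (x (j + i)) - ncf_trunc x (m - Suc i) (Suc (j + i)))" by simp
qed (use assms trunc_range trunc_le_R in auto)

lemma R_power_small: "0 < d \<Longrightarrow> \<exists>n. R ^ (2 * n) < d"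
  using real_arch_pow_inv[of d "R\<^sup>2"] R_bounds power_less_one_iff[of R 2]
  by (auto simp: power_mult)

lemma trunc_tendsto:
  assumes "1 \<le> j"
  shows "(\<lambda>n. ncf_trunc x n j) \<longlonglongrightarrow> v j"
proof -
  have "Cauchy (\<lambda>n. ncf_trunc x n j)"
  proof (rule metric_CauchyI)
    fix d :: real assume "0 < d"
    then obtain n where n: "R ^ (2 * n) < d / 2" using R_power_small[of "d / 2"] by auto
    have "dist (ncf_trunc x m j) (ncf_trunc x m' j) < d" if "m \<ge> n" "m' \<ge> n" for m m'
      using trunc_approx[OF assms that(1)] trunc_approx[OF assms that(2)] n
      unfolding dist_real_def by linarith
    then show "\<exists>n. \<forall>m\<ge>n. \<forall>m'\<ge>n. dist (ncf_trunc x m j) (ncf_trunc x m' j) < d" by blast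
  qed
  then show ?thesis unfolding ncf_value_def
    by (simp add: Cauchy_convergent_iff convergent_LIMSEQ_iff)
qed

lemma v_range: "1 \<le> j \<Longrightarrow> 0 \<le> v j \<and> v j \<le> R"
  using LIMSEQ_le_const[OF trunc_tendsto, of j 0] LIMSEQ_le_const2[OF trunc_tendsto, of j R]
    trunc_range trunc_le_R by blast

lemma v_step:
  assumes "1 \<le> j"
  shows "v j = 1 / (x j - v (Suc j))"
proof -
  have "2 \<le> real_of_int (x j)" using digit_ge[OF assms] by linarith
  moreover have "v (Suc j) < 1" using v_range[of "Suc j"] R_bounds by simp
  ultimately have "(\<lambda>n. ncf_trunc x (Suc n) j) \<longlonglongrightarrow> 1 / (x j - v (Suc j))"
    unfolding ncf_trunc.simps by (intro tendsto_intros trunc_tendsto) auto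
  moreover have "(\<lambda>n. ncf_trunc x (Suc n) j) \<longlonglongrightarrow> v j"
    using trunc_tendsto[OF assms] by (rule LIMSEQ_Suc)
  ultimately show ?thesis using LIMSEQ_unique by blast
qed

lemma v_lower:
  assumes "1 \<le> j"
  shows "1 / M \<le> v j" "0 < v j" "v j \<le> R" "v j < 1"
proof -
  have x: "2 \<le> real_of_int (x j)" "real_of_int (x j) \<le> M"
    using digit_ge[OF assms] digit_le[OF assms] by linarith+
  have "0 \<le> v (Suc j)" "v (Suc j) < 1" using v_range[of "Suc j"] R_bounds by auto
  from ncf_step_lower[OF x this] v_step[OF assms] v_range[OF assms] R_bounds
  show "1 / M \<le> v j" "0 < v j" "v j \<le> R" "v j < 1" by auto
qed

lemma v_step': "1 \<le> j \<Longrightarrow> v j * (x j - v (Suc j)) = 1"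
  using v_step[of j] v_lower[of j] by (cases "x j = v (Suc j)") auto

lemma ceiling_v: "1 \<le> j \<Longrightarrow> \<lceil>1 / v j\<rceil> = x j"
  using v_step[of j] v_lower[of "Suc j"] by (intro ceiling_unique) auto

text \<open>Both \<open>v j\<close> and \<open>h k 0\<close> are within \<open>R ^ (2 * n)\<close>
  of the same truncation as soon as the window of h has length n. This later identifies the limits
  of tails and of reversed fractions along the blocks.\<close>

lemma window_limit:
  fixes h :: "'k \<Rightarrow> nat \<Rightarrow> real"
  assumes "1 \<le> j"
    and "\<And>n. eventually (\<lambda>k. \<forall>i<n. h k i = 1 / (x (j + i) - h k (Suc i))) F"
    and "\<And>n. eventually (\<lambda>k. \<forall>i\<le>n. 0 \<le> h k i \<and> h k i \<le> R) F"
  shows "((\<lambda>k. h k 0) \<longlongrightarrow> v j) F"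
proof (rule tendstoI)
  fix d :: real assume "0 < d"
  then obtain n where n: "R ^ (2 * n) < d / 2" using R_power_small[of "d / 2"] by auto
  have v: "\<bar>v j - ncf_trunc x n j\<bar> \<le> R ^ (2 * n)"
  proof (rule window_approx[of n "\<lambda>i. v (j + i)" j, simplified])
    show "v (j + i) = 1 / (real_of_int (x (j + i)) - v (Suc (j + i)))" for i
      using assms(1) by (intro v_step) simp
  qed (use assms(1) v_range in auto)
  show "eventually (\<lambda>k. dist (h k 0) (v j) < d) F"
    using assms(2)[of n] assms(3)[of n]
  proof eventually_elim
    case (elim k)
    then have "\<bar>h k 0 - ncf_trunc x n j\<bar> \<le> R ^ (2 * n)"
      using assms(1) by (intro window_approx) auto
    then show ?case using v n unfolding dist_real_def by linarith
  qed
qed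

lemma ncf_rem_value:
  assumes "1 \<le> j"
  shows "ncf_rem (v j) (Suc i) = v (j + i)"
  using assms
proof (induction i)
  case (Suc i)
  then show ?case using ceiling_v[of "j + i"] v_step[of "j + i"] by simp
qed simp

lemma ncf_digit_value: "1 \<le> j \<Longrightarrow> ncf_digit (v j) (Suc i) = x (j + i)"
  unfolding ncf_digit_def by (simp add: ncf_rem_value ceiling_v)

lemma ncf_D_value: "1 \<le> j \<Longrightarrow> ncf_D (v j) n = (\<Prod>i<n. v (j + i))"
  unfolding ncf_D_def
  by (simp add: prod.atLeast1_atMost_eq ncf_rem_value)

lemma shift: "bounded_ncf (\<lambda>i. x (i + m)) M N"
proof
  fix j :: nat assume "1 \<le> j"
  then show "2 \<le> x (j + m)" "x (j + m) \<le> M" "\<exists>i<N. 3 \<le> x (j + i + m)"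
    using digit_ge[of "j + m"] digit_le[of "j + m"] no_twos[of "j + m"] by (auto simp: ac_simps)
qed

end

section \<open>From an irrational number to its digit sequence\<close>

lemma ncf_rem_irrational:
  assumes "0 < \<gamma>" "\<gamma> < 1" "\<gamma> \<notin> \<rat>"
  shows "0 < ncf_rem \<gamma> i \<and> ncf_rem \<gamma> i < 1 \<and> ncf_rem \<gamma> i \<notin> \<rat>"
  using assms
proof (induction \<gamma> i rule: ncf_rem.induct)
  case (3 \<gamma> i)
  let ?z = "1 / ncf_rem \<gamma> (Suc i)"
  have "?z \<notin> \<rat>"
  proof
    assume "?z \<in> \<rat>"
    from Rats_inverse[OF this] show False using 3 by simp
  qed
  then have *: "of_int \<lceil>?z\<rceil> - ?z \<notin> \<rat>"
    using Rats_diff[OF Rats_of_int, of "of_int \<lceil>?z\<rceil> - ?z" "\<lceil>?z\<rceil>"] by auto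
  \<comment> \<open>Irrationality makes the ceiling strict, so the next remainder does not
    vanish.\<close>
  then have "of_int \<lceil>?z\<rceil> - ?z \<noteq> 0" by (metis Rats_0)
  then have "?z < of_int \<lceil>?z\<rceil>" using le_of_int_ceiling[of ?z] by linarith
  moreover have "of_int \<lceil>?z\<rceil> - 1 < ?z" using ceiling_correct[of ?z] by linarith
  ultimately have "0 < of_int \<lceil>?z\<rceil> - ?z" "of_int \<lceil>?z\<rceil> - ?z < 1" by linarith+
  then show ?case using * unfolding ncf_rem.simps by blast
qed auto

lemma ncf_rem_step:
  assumes "1 \<le> i"
  shows "ncf_rem \<gamma> (Suc i) = ncf_digit \<gamma> i - 1 / ncf_rem \<gamma> i"
  using assms by (cases i) (auto simp: ncf_digit_def)

lemma ncf_digit_ge_2: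
  assumes "0 < ncf_rem \<gamma> i" "ncf_rem \<gamma> i < 1"
  shows "2 \<le> ncf_digit \<gamma> i"
proof -
  have "1 < 1 / ncf_rem \<gamma> i" using assms by simp
  then have "1 < \<lceil>1 / ncf_rem \<gamma> i\<rceil>" by (simp add: less_ceiling_iff)
  then show ?thesis unfolding ncf_digit_def by simp
qed

text \<open>The remainders satisfy the recursion on every window and stay below \<open>R\<close>, so
  \<open>window_limit\<close> applies to the constant family.\<close>

lemma ncf_rem_eq_value:
  assumes "bounded_ncf (ncf_digit \<gamma>) M N" "0 < \<gamma>" "\<gamma> < 1" "\<gamma> \<notin> \<rat>" "1 \<le> j"
  shows "ncf_rem \<gamma> j = ncf_value (ncf_digit \<gamma>) j"
proof -
  interpret bounded_ncf "ncf_digit \<gamma>" M N by fact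
  have rng: "0 < ncf_rem \<gamma> i" "ncf_rem \<gamma> i < 1" for i
    using ncf_rem_irrational assms by blast+
  have step: "ncf_rem \<gamma> (i + j) = 1 / (ncf_digit \<gamma> (i + j) - ncf_rem \<gamma> (Suc i + j))" if "1 \<le> j" for i j
    using ncf_rem_step[of "i + j" \<gamma>] that by simp
  have le: "ncf_rem \<gamma> j \<le> R" if "1 \<le> j" for j
  proof -
    have "ncf_rem \<gamma> (0 + j) \<le> real N / (real N + 1)"
    proof (rule ncf_iterate_bound[where n = N and h = "\<lambda>i. ncf_rem \<gamma> (i + j)" and x = "ncf_digit \<gamma>" and j = j])
      show "ncf_rem \<gamma> (i + j) = 1 / (ncf_digit \<gamma> (j + i) - ncf_rem \<gamma> (Suc i + j))" for i
        using step[OF that, of i] by (simp only: add.commute)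
    qed (use digit_ge no_twos[OF that] that rng less_imp_le[OF rng(1)] in auto)
    then show ?thesis by (simp add: R_def)
  qed
  have "((\<lambda>k::nat. ncf_rem \<gamma> (0 + j)) \<longlongrightarrow> ncf_value (ncf_digit \<gamma>) j) sequentially"
  proof (rule window_limit[where h = "\<lambda>_ i. ncf_rem \<gamma> (i + j)"])
    show "\<forall>\<^sub>F _ in sequentially. \<forall>i<n. ncf_rem \<gamma> (i + j) =
        1 / (ncf_digit \<gamma> (j + i) - ncf_rem \<gamma> (Suc i + j))" for n
    proof (intro always_eventually allI impI)
      fix i :: nat
      show "ncf_rem \<gamma> (i + j) = 1 / (ncf_digit \<gamma> (j + i) - ncf_rem \<gamma> (Suc i + j))"
        using step[OF assms(5), of i] unfolding add.commute[of j i] .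
    qed
    show "\<forall>\<^sub>F _ in sequentially. \<forall>i\<le>n. 0 \<le> ncf_rem \<gamma> (i + j) \<and> ncf_rem \<gamma> (i + j) \<le> R" for n
      using le less_imp_le[OF rng(1)] assms(5) by (intro always_eventually) simp
  qed fact
  then show ?thesis by (simp add: tendsto_const_iff)
qed

section \<open>Continuants\<close>

text \<open>Denominators of the convergents with the index shifted by one:
  \<open>continuant x (Suc n)\<close> belongs to the convergent with n partial quotients. With the
  initial values of \<open>numerator\<close>, index 0 then corresponds to
  \<open>D 0 = 1\<close>.\<close>

fun continuant :: "(nat \<Rightarrow> int) \<Rightarrow> nat \<Rightarrow> int" where
  "continuant x 0 = 0"
| "continuant x (Suc 0) = 1"
| "continuant x (Suc (Suc n)) = x (Suc n) * continuant x (Suc n) - continuant x n"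

fun numerator :: "(nat \<Rightarrow> int) \<Rightarrow> nat \<Rightarrow> int" where
  "numerator x 0 = -1"
| "numerator x (Suc 0) = 0"
| "numerator x (Suc (Suc n)) = x (Suc n) * numerator x (Suc n) - numerator x n"

lemma continuant_det:
  "continuant x (Suc n) * numerator x n - continuant x n * numerator x (Suc n) = -1"
  by (induction n) (auto simp: algebra_simps)

text \<open>The determinant is -1, so two consecutive pairs form a basis of the integer lattice; i
  and j come from Cramer's rule.\<close>

lemma continuant_basis:
  fixes q p :: int
  obtains i j where "q = i * continuant x n + j * continuant x (Suc n)"
    "p = i * numerator x n + j * numerator x (Suc n)"
proof -
  let ?Q = "continuant x n" and ?Q' = "continuant x (Suc n)"
  let ?P = "numerator x n" and ?P' = "numerator x (Suc n)"
  have det: "?Q' * ?P - ?Q * ?P' = -1" by (rule continuant_det)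
  define i where "i = q * ?P' - p * ?Q'"
  define j where "j = p * ?Q - q * ?P"
  have "q = i * ?Q + j * ?Q'" "p = i * ?P + j * ?P'"
    unfolding i_def j_def using det by algebra+
  then show ?thesis by (rule that)
qed

section \<open>Sizes of the numbers D, of the continuants and of their ratios\<close>

context bounded_ncf
begin

abbreviation Q :: "nat \<Rightarrow> int" where "Q \<equiv> continuant x"

definition D :: "nat \<Rightarrow> real" where "D n = (\<Prod>i<n. v (Suc i))"

text \<open>The fraction read backwards, with digits \<open>x n, ..., x 1\<close>: the left
  counterpart of the tail \<open>v (Suc n)\<close>.\<close>

definition theta :: "nat \<Rightarrow> real" where "theta n = Q n / Q (Suc n)"

lemma D_0 [simp]: "D 0 = 1"
  by (simp add: D_def)

lemma D_Suc: "D (Suc n) = D n * v (Suc n)"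
  by (simp add: D_def)

lemma D_pos: "0 < D n"
  unfolding D_def using v_lower by (intro prod_pos) auto

lemma D_rec: "D n = x (Suc n) * D (Suc n) - D (Suc (Suc n))"
proof -
  have "D n = D n * (v (Suc n) * (x (Suc n) - v (Suc (Suc n))))" using v_step'[of "Suc n"] by simp
  then show ?thesis by (simp add: D_Suc algebra_simps)
qed

lemma D_eq: "D n = Q n * v 1 - numerator x n"
proof (induction n rule: induct_nat_012)
  case (ge2 n)
  then show ?case using D_rec[of n] by (simp add: algebra_simps)
qed (auto simp: D_def)

lemma D_Suc_le: "D (Suc n) \<le> R * D n"
  using v_lower[of "Suc n"] D_pos[of n] by (simp add: D_Suc mult.commute)

lemma D_Suc_less: "D (Suc n) < D n"
  using v_lower[of "Suc n"] D_pos[of n] by (simp add: D_Suc)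

lemma D_add: "D (n + k) = D n * (\<Prod>i<k. v (Suc (n + i)))"
  by (induction k) (auto simp: D_Suc)

lemma prod_v_bounds: "1 \<le> j \<Longrightarrow> 1 / of_int M ^ k \<le> (\<Prod>i<k. v (j + i)) \<and> (\<Prod>i<k. v (j + i)) \<le> R ^ k"
proof (induction k)
  case (Suc k)
  have M: "0 < real_of_int M" using M_ge by simp
  have "1 / of_int M ^ k * (1 / of_int M) \<le> (\<Prod>i<k. v (j + i)) * v (j + k)"
    using Suc v_lower[of "j + k"] M by (intro mult_mono) (auto intro!: prod_nonneg v_range[THEN conjunct1])
  moreover have "(\<Prod>i<k. v (j + i)) * v (j + k) \<le> R ^ k * R"
    using Suc v_lower[of "j + k"] R_bounds by (intro mult_mono) auto
  ultimately show ?case by (simp add: mult.commute)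
qed simp

lemma D_add_bounds: "D n / of_int M ^ k \<le> D (n + k)" "D (n + k) \<le> D n * R ^ k"
proof -
  have "1 / of_int M ^ k \<le> (\<Prod>i<k. v (Suc (n + i)))" "(\<Prod>i<k. v (Suc (n + i))) \<le> R ^ k"
    using prod_v_bounds[of "Suc n" k] by auto
  from this[THEN mult_left_mono, of "D n"] D_pos[of n]
  show "D n / of_int M ^ k \<le> D (n + k)" "D (n + k) \<le> D n * R ^ k"
    unfolding D_add by auto
qed

lemma D_le: "D n \<le> R ^ n"
  using D_add_bounds(2)[of 0 n] by simp

lemma Q_bounds: "0 \<le> Q n \<and> Q n < Q (Suc n)"
proof (induction n)
  case (Suc n)
  have "2 * Q (Suc n) \<le> x (Suc n) * Q (Suc n)"
    using Suc digit_ge[of "Suc n"] by (intro mult_right_mono) auto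
  then show ?case using Suc unfolding continuant.simps by linarith
qed simp

lemma Q_pos: "0 < Q (Suc n)"
  using Q_bounds[of n] by simp

lemma Q_ge: "int n \<le> Q n"
proof (induction n)
  case (Suc n)
  then show ?case using Q_bounds[of n] by simp
qed simp

text \<open>The determinant identity \<open>continuant_det\<close> after \<open>D_eq\<close> has
  brought in the numbers \<open>D\<close> for the numerators.\<close>

lemma Q_D: "Q (Suc n) * D n - Q n * D (Suc n) = 1"
proof -
  have "real_of_int (Q (Suc n) * numerator x n - Q n * numerator x (Suc n)) = -1"
    unfolding continuant_det by simp
  then show ?thesis unfolding D_eq by (simp add: algebra_simps)
qed

lemma theta_0 [simp]: "theta 0 = 0"
  by (simp add: theta_def)

lemma theta_Suc: "theta (Suc n) = 1 / (x (Suc n) - theta n)"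
  using Q_pos[of n] Q_pos[of "Suc n"] by (simp add: theta_def field_simps)

lemma theta_range: "0 \<le> theta n \<and> theta n < 1"
  using Q_bounds[of n] by (simp add: theta_def)

text \<open>Mirror image of \<open>trunc_bound\<close>: reaching the beginning of the sequence
  resets the bound, because \<open>theta 0 = 0\<close>.\<close>

lemma theta_bound:
  fixes k :: nat
  shows "n < k \<or> (\<exists>i\<le>n. n < i + k \<and> 1 \<le> i \<and> 3 \<le> x i) \<Longrightarrow> theta n \<le> k / (k + 1)"
proof (induction n arbitrary: k)
  case (Suc n)
  show ?case
  proof (cases "3 \<le> x (Suc n)")
    case True
    then show ?thesis using theta_range[of n] Suc.prems ncf_step_three[of "x (Suc n)" "theta n" k]
      by (auto simp: theta_Suc add.commute)
  next
    case False
    obtain l where k: "k = Suc l" using Suc.prems by (cases k) auto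
    have "theta n \<le> l / (l + 1)"
      using Suc.prems False k by (intro Suc.IH) (auto simp: le_Suc_eq)
    then show ?thesis using k ncf_step_two[of "x (Suc n)" "theta n" l] digit_ge[of "Suc n"]
      by (simp add: theta_Suc add.commute)
  qed
qed simp

lemma theta_le_R: "theta n \<le> R"
proof -
  have "n < N \<or> (\<exists>i\<le>n. n < i + N \<and> 1 \<le> i \<and> 3 \<le> x i)"
  proof (cases "n < N")
    case False
    then have "1 \<le> Suc n - N" by simp
    from no_twos[OF this] obtain i where "i < N" "3 \<le> x (Suc n - N + i)" by blast
    with False show ?thesis by (intro disjI2 exI[of _ "Suc n - N + i"]) auto
  qed simp
  from theta_bound[OF this] show ?thesis by (simp add: R_def add.commute)
qed

lemma theta_lower: "1 / M \<le> theta (Suc n)"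
  using theta_range[of n] digit_ge[of "Suc n"] digit_le[of "Suc n"]
    ncf_step_lower(1)[of "x (Suc n)" M "theta n"] by (simp add: theta_Suc)

text \<open>Two backward digits are used: \<open>theta (Suc n)\<close> is at least 1/M, so the
  denominator is at most M - 1/M. This is the source of the factor \<open>M\<^sup>2 - 1\<close> in
  the condition on L.\<close>

lemma theta_lower': "of_int M / ((of_int M)\<^sup>2 - 1) \<le> theta (Suc (Suc n))"
proof -
  have M: "3 \<le> real_of_int M" using M_ge by simp
  then have "1 / of_int M \<le> (1::real)" by simp
  then have M': "0 < of_int M - 1 / real_of_int M" using M by linarith
  have "of_int M - 1 / real_of_int M = ((of_int M)\<^sup>2 - 1) / of_int M"
    using M by (simp add: diff_divide_distrib power2_eq_square)
  then have "real_of_int M / ((of_int M)\<^sup>2 - 1) = 1 / (of_int M - 1 / of_int M)"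
    by simp
  also have "\<dots> \<le> 1 / (x (Suc (Suc n)) - theta (Suc n))"
  proof (intro divide_left_mono mult_pos_pos)
    show "x (Suc (Suc n)) - theta (Suc n) \<le> of_int M - 1 / real_of_int M"
      using theta_lower[of n] digit_le[of "Suc (Suc n)"]
      by (intro diff_mono) auto
    have "2 \<le> real_of_int (x (Suc (Suc n)))" using digit_ge[of "Suc (Suc n)"] by linarith
    then show "0 < x (Suc (Suc n)) - theta (Suc n)" using theta_range[of "Suc n"] by linarith
  qed (use M' in auto)
  finally show ?thesis unfolding theta_Suc[of "Suc n"] .
qed

lemma Q_diff: "k \<le> n \<Longrightarrow> Q (n - k) = Q n * (\<Prod>i<k. theta (n - Suc i))"
proof (induction k)
  case (Suc k)
  then obtain m where m: "n - k = Suc m" "n - Suc k = m" by (metis Suc_diff_Suc Suc_le_lessD)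
  have "real_of_int (Q m) = Q (Suc m) * theta m" using Q_pos[of m] by (simp add: theta_def)
  then show ?case using Suc m by simp
qed simp

lemma prod_theta_lower: "k < n \<Longrightarrow> 1 / of_int M ^ k \<le> (\<Prod>i<k. theta (n - Suc i))"
proof (induction k)
  case (Suc k)
  have M: "0 < real_of_int M" using M_ge by simp
  obtain m where m: "n - Suc k = Suc m" using Suc.prems by (metis Suc_diff_Suc)
  have "1 / of_int M ^ k * (1 / of_int M) \<le> (\<Prod>i<k. theta (n - Suc i)) * theta (n - Suc k)"
    unfolding m using Suc theta_lower[of m] M
    by (intro mult_mono) (auto intro!: prod_nonneg theta_range[THEN conjunct1])
  then show ?case by (simp add: mult.commute)
qed simp

lemma Q_lower:
  assumes "1 \<le> m" "m \<le> n"
  shows "Q n / of_int M ^ (n - m) \<le> Q m"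
proof -
  have "1 / of_int M ^ (n - m) \<le> (\<Prod>i<n - m. theta (n - Suc i))"
    using assms by (intro prod_theta_lower) auto
  then have "Q n * (1 / of_int M ^ (n - m)) \<le> Q n * (\<Prod>i<n - m. theta (n - Suc i))"
    using Q_bounds[of n] by (intro mult_left_mono) auto
  then show ?thesis using Q_diff[of "n - m" n] assms by simp
qed

text \<open>Factoring \<open>Q (Suc n) * D n\<close> out of \<open>Q_D\<close>. In the limit this
  yields the denominator of the theorem.\<close>

lemma QD_eq: "Q (Suc n) * D n * (1 - theta n * v (Suc n)) = 1"
proof -
  have "real_of_int (Q n) = Q (Suc n) * theta n" using Q_pos[of n] by (simp add: theta_def)
  then show ?thesis using Q_D[of n] unfolding D_Suc by algebra
qed

lemma theta_v_bounds: "0 \<le> theta n * v (Suc n)" "theta n * v (Suc n) \<le> R\<^sup>2" "theta n * v (Suc n) < 1"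
proof -
  show "0 \<le> theta n * v (Suc n)" using theta_range[of n] v_lower[of "Suc n"] by simp
  show "theta n * v (Suc n) \<le> R\<^sup>2" unfolding power2_eq_square
    using theta_range[of n] theta_le_R[of n] v_lower[of "Suc n"] R_bounds by (intro mult_mono) auto
  also have "R\<^sup>2 < 1" using R_bounds power_less_one_iff[of R 2] by simp
  finally show "theta n * v (Suc n) < 1" .
qed

lemma QD_ge_1: "1 \<le> Q (Suc n) * D n"
proof -
  have "0 \<le> Q n * D (Suc n)" using Q_bounds[of n] D_pos[of "Suc n"] by simp
  then show ?thesis using Q_D[of n] by linarith
qed

end

section \<open>Expansions in the numbers D and their approximation products\<close>

text \<open>The two diagonal terms of the expanded product are controlled directly; the cross term
  \<open>x * y' + x' * y\<close> is at least \<open>2 * c\<close> by the inequality between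
  arithmetic and geometric mean.\<close>

lemma product_segment_ge:
  fixes c :: real
  assumes "0 \<le> c" "0 \<le> x" "0 \<le> y" "0 \<le> x'" "0 \<le> y'" "0 \<le> l" "l \<le> 1"
    and "c \<le> x * y" "c \<le> x' * y'"
  shows "c \<le> ((1 - l) * x + l * x') * ((1 - l) * y + l * y')"
proof -
  have "c\<^sup>2 \<le> (x * y) * (x' * y')"
    unfolding power2_eq_square using assms by (intro mult_mono) auto
  moreover have "4 * ((x * y') * (x' * y)) \<le> (x * y' + x' * y)\<^sup>2"
    using zero_le_power2[of "x * y' - x' * y"] by (simp add: power2_eq_square algebra_simps)
  ultimately have "(2 * c)\<^sup>2 \<le> (x * y' + x' * y)\<^sup>2" by (simp add: power2_eq_square algebra_simps)
  then have cross: "2 * c \<le> x * y' + x' * y"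
    using assms by (intro power2_le_imp_le[of "2 * c"]) auto
  have "c = (1 - l)\<^sup>2 * c + l\<^sup>2 * c + l * (1 - l) * (2 * c)"
    by (simp add: power2_eq_square algebra_simps)
  also have "\<dots> \<le> (1 - l)\<^sup>2 * (x * y) + l\<^sup>2 * (x' * y') + l * (1 - l) * (x * y' + x' * y)"
    using assms cross by (intro add_mono mult_left_mono) auto
  also have "\<dots> = ((1 - l) * x + l * x') * ((1 - l) * y + l * y')"
    by (simp add: power2_eq_square algebra_simps)
  finally show ?thesis .
qed

lemma unbounded_bracket:
  fixes g :: "nat \<Rightarrow> int"
  assumes "g m \<le> q" and "\<And>B. \<exists>n. B < g n" and "mono g"
  obtains n where "m \<le> n" "g n \<le> q" "q < g (Suc n)"
proof -
  define k where "k = (LEAST n. q < g n)"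
  have k: "q < g k" unfolding k_def using assms(2)[of q] by (rule LeastI_ex)
  have less: "g n \<le> q" if "n < k" for n
    using not_less_Least[of n "\<lambda>n. q < g n"] that by (simp add: k_def not_less)
  have "m < k"
  proof (rule ccontr)
    assume "\<not> m < k"
    then have "g k \<le> g m" using monoD[OF assms(3), of k m] by simp
    then show False using k assms(1) by simp
  qed
  then obtain n where "k = Suc n" "m \<le> n" by (cases k) auto
  then show ?thesis using k less that by auto
qed

text \<open>A maximal digit must be followed, after digits \<open>x l - 2\<close> only, by a digit
  at most \<open>x j - 3\<close>. The uniform bound Z on the waiting time is what keeps
  \<open>D n - T n\<close> comparable to \<open>D n\<close>.\<close>

locale digit_expansion = bounded_ncf x M N for x M N +
  fixes b :: "nat \<Rightarrow> int" and Z :: nat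
  assumes b_nonneg: "0 \<le> b k"
    and b_le: "1 \<le> k \<Longrightarrow> b k \<le> x k - 1"
    and b_break: "1 \<le> k \<Longrightarrow> b k = x k - 1 \<Longrightarrow>
      \<exists>j. k < j \<and> j \<le> k + Z \<and> b j \<le> x j - 3 \<and> (\<forall>l. k < l \<and> l < j \<longrightarrow> b l = x l - 2)"
    and b_infinite: "\<exists>k>n. 1 \<le> b k"
begin

definition T :: "nat \<Rightarrow> real" where
  "T n = (\<Sum>k. of_int (b (Suc (n + k))) * D (Suc (n + k)))"

definition Nq :: "nat \<Rightarrow> int" where "Nq n = (\<Sum>k<n. b (Suc k) * Q (Suc k))"

definition Np :: "nat \<Rightarrow> int" where "Np n = (\<Sum>k<n. b (Suc k) * numerator x (Suc k))"

lemma Nq_simps [simp]: "Nq 0 = 0" "Nq (Suc n) = Nq n + b (Suc n) * Q (Suc n)"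
  by (auto simp: Nq_def)

lemma Np_simps [simp]: "Np 0 = 0" "Np (Suc n) = Np n + b (Suc n) * numerator x (Suc n)"
  by (auto simp: Np_def)

lemma T_summable: "summable (\<lambda>k. of_int (b (Suc (n + k))) * D (Suc (n + k)))"
proof (rule summable_comparison_test')
  show "summable (\<lambda>k. of_int M * R ^ k)"
    using R_bounds by (intro summable_mult summable_geometric) auto
  fix k :: nat
  have "0 \<le> real_of_int (b (Suc (n + k)))" "real_of_int (b (Suc (n + k))) \<le> M"
    using b_nonneg[of "Suc (n + k)"] b_le[of "Suc (n + k)"] digit_le[of "Suc (n + k)"] by auto
  moreover have "D (Suc (n + k)) \<le> R ^ k"
    using D_le[of "Suc (n + k)"] R_bounds power_decreasing[of k "Suc (n + k)" R] by simp
  ultimately have "of_int (b (Suc (n + k))) * D (Suc (n + k)) \<le> of_int M * R ^ k"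
    using D_pos[of "Suc (n + k)"] by (intro mult_mono) auto
  then show "norm (of_int (b (Suc (n + k))) * D (Suc (n + k))) \<le> of_int M * R ^ k"
    using D_pos[of "Suc (n + k)"] b_nonneg[of "Suc (n + k)"] by (simp add: abs_mult)
qed

lemma T_rec: "T n = b (Suc n) * D (Suc n) + T (Suc n)"
  using suminf_split_head[OF T_summable[of n]] by (simp add: T_def)

lemma T_nonneg: "0 \<le> T n"
  unfolding T_def using b_nonneg D_pos
  by (intro suminf_nonneg T_summable mult_nonneg_nonneg) (auto simp: less_imp_le)

lemma T_antimono: "n \<le> m \<Longrightarrow> T m \<le> T n"
proof (induction rule: dec_induct)
  case (step m)
  have "0 \<le> b (Suc m) * D (Suc m)" using b_nonneg[of "Suc m"] D_pos[of "Suc m"] by simp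
  then show ?case using step T_rec[of m] by simp
qed simp

lemma T_ge_D:
  assumes "n < m" "1 \<le> b m"
  shows "D m \<le> T n"
proof -
  obtain k where k: "m = Suc k" "n \<le> k" using assms by (cases m) auto
  have "1 * D m \<le> b m * D m" using assms D_pos[of m] by (intro mult_right_mono) auto
  then show ?thesis using T_rec[of k] T_nonneg[of m] T_antimono[OF k(2)] k by simp
qed

lemma T_pos: "0 < T n"
proof -
  obtain k where "n < k" "1 \<le> b k" using b_infinite by blast
  from T_ge_D[OF this] show ?thesis using D_pos[of k] by simp
qed

text \<open>Behind a maximal digit the plain bound is too weak: the next sum must be at most
  \<open>D (Suc n) - D (Suc (Suc n))\<close>. The second clause provides this, and a digit
  \<open>x l - 2\<close> passes it on unchanged.\<close>

lemma partial_tail_le: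
  defines "S \<equiv> \<lambda>n m. \<Sum>k<m. of_int (b (Suc (n + k))) * D (Suc (n + k))"
    and "broken \<equiv> \<lambda>n. \<exists>j>n. b j \<le> x j - 3 \<and> (\<forall>l. n < l \<and> l < j \<longrightarrow> b l = x l - 2)"
  shows "S n m \<le> D n \<and> (broken n \<longrightarrow> S n m \<le> D n - D (Suc n))"
proof (induction m arbitrary: n)
  case 0
  show ?case using D_pos[of n] D_Suc_less[of n] by (auto simp: S_def)
next
  case (Suc m)
  have S: "S n (Suc m) = b (Suc n) * D (Suc n) + S (Suc n) m"
    unfolding S_def by (subst sum.lessThan_Suc_shift) simp
  have D: "D n = x (Suc n) * D (Suc n) - D (Suc (Suc n))" by (rule D_rec)
  have pos: "0 < D (Suc n)" "D (Suc (Suc n)) < D (Suc n)" using D_pos D_Suc_less by auto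
  have le: "b (Suc n) * D (Suc n) \<le> (x (Suc n) - i) * D (Suc n)"
    if "b (Suc n) \<le> x (Suc n) - i" for i :: int
  proof -
    have "real_of_int (b (Suc n)) \<le> real_of_int (x (Suc n) - i)" using that by (simp only: of_int_le_iff)
    then show ?thesis using pos by (intro mult_right_mono) auto
  qed
  have small: "S n (Suc m) \<le> D n - D (Suc n)" if "b (Suc n) \<le> x (Suc n) - 3"
    using le[OF that] S D Suc.IH[of "Suc n"] pos by (simp add: algebra_simps)
  have "S n (Suc m) \<le> D n"
  proof (cases "b (Suc n) = x (Suc n) - 1")
    case True
    from b_break[OF _ True] have "broken (Suc n)" unfolding broken_def by auto
    then have "S (Suc n) m \<le> D (Suc n) - D (Suc (Suc n))" using Suc.IH by blast
    moreover have "b (Suc n) * D (Suc n) = (x (Suc n) - 1) * D (Suc n)" using True by simp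
    ultimately show ?thesis using S D by (simp add: algebra_simps)
  next
    case False
    then have "b (Suc n) \<le> x (Suc n) - 2" using b_le[of "Suc n"] by simp
    from le[OF this] show ?thesis using S D Suc.IH[of "Suc n"] pos by (simp add: algebra_simps)
  qed
  moreover have "S n (Suc m) \<le> D n - D (Suc n)" if "broken n"
  proof -
    from that[unfolded broken_def] obtain j where
      j: "n < j" "b j \<le> x j - 3" "\<forall>l. n < l \<and> l < j \<longrightarrow> b l = x l - 2" by (elim exE conjE)
    show ?thesis
    proof (cases "j = Suc n")
      case True
      then show ?thesis using j small by simp
    next
      case False
      then have "broken (Suc n)" unfolding broken_def using j by (auto intro!: exI[of _ j])
      then have "S (Suc n) m \<le> D (Suc n) - D (Suc (Suc n))" using Suc.IH by blast
      moreover have "b (Suc n) = x (Suc n) - 2" using False j by auto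
      ultimately show ?thesis using le[of 2] S D by (simp add: algebra_simps)
    qed
  qed
  ultimately show ?case by blast
qed

lemma T_le_D: "T n \<le> D n"
  unfolding T_def by (intro suminf_le_const T_summable partial_tail_le[THEN conjunct1])

text \<open>Following a maximal digit, the gap to the upper end of the interval is passed on unchanged
  through the digits \<open>x l - 2\<close> until the first smaller digit.\<close>

lemma gap_after_break:
  assumes "n < j" "b j \<le> x j - 3" "\<And>l. n < l \<Longrightarrow> l < j \<Longrightarrow> b l = x l - 2"
  shows "(1 - R) * D j \<le> D n - D (Suc n) - T n"
  using assms
proof (induction "j - Suc n" arbitrary: n)
  case 0
  then have j: "j = Suc n" by simp
  have "b j * D j \<le> (x j - 3) * D j"
    using 0 D_pos[of j] by (intro mult_right_mono) auto
  then show ?case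
    using j D_rec[of n] T_rec[of n] T_le_D[of "Suc n"] D_Suc_le[of "Suc n"] by (simp add: algebra_simps)
next
  case (Suc d)
  have "b (Suc n) = x (Suc n) - 2" using Suc by auto
  then have "b (Suc n) * D (Suc n) = (x (Suc n) - 2) * D (Suc n)" by simp
  moreover have "(1 - R) * D j \<le> D (Suc n) - D (Suc (Suc n)) - T (Suc n)"
    using Suc by (intro Suc.hyps) auto
  ultimately show ?case using D_rec[of n] T_rec[of n] by (simp add: algebra_simps)
qed

text \<open>A maximal digit hands the gap over to the break supplied by \<open>b_break\<close>; any
  smaller digit leaves at least \<open>D (Suc n) - D (Suc (Suc n))\<close> at once.\<close>

lemma gap_lower:
  obtains j where "j \<le> Suc n + Z" "n < j" "(1 - R) * D j \<le> D n - T n"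
proof (cases "b (Suc n) = x (Suc n) - 1")
  case True
  have "1 \<le> Suc n" by simp
  from b_break[OF this True] obtain j where j: "Suc n < j" "j \<le> Suc n + Z" "b j \<le> x j - 3"
    "\<forall>l. Suc n < l \<and> l < j \<longrightarrow> b l = x l - 2" by (elim exE conjE)
  then have "(1 - R) * D j \<le> D (Suc n) - D (Suc (Suc n)) - T (Suc n)"
    by (intro gap_after_break) auto
  also have "\<dots> = D n - T n"
  proof -
    have "b (Suc n) * D (Suc n) = (x (Suc n) - 1) * D (Suc n)" using True by simp
    then show ?thesis using D_rec[of n] T_rec[of n] by (simp add: algebra_simps)
  qed
  finally show ?thesis using j by (intro that[of j]) auto
next
  case False
  then have "b (Suc n) * D (Suc n) \<le> (x (Suc n) - 2) * D (Suc n)"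
    using b_le[of "Suc n"] D_pos[of "Suc n"] by (intro mult_right_mono) auto
  then show ?thesis
    using D_rec[of n] T_rec[of n] T_le_D[of "Suc n"] D_Suc_le[of "Suc n"]
    by (intro that[of "Suc n"]) (auto simp: algebra_simps)
qed

lemma T_less_D: "T n < D n"
proof -
  obtain j where "(1 - R) * D j \<le> D n - T n" by (rule gap_lower)
  moreover have "0 < (1 - R) * D j" using R_bounds D_pos[of j] by simp
  ultimately show ?thesis by linarith
qed

lemma Nq_point: "Nq n * v 1 - Np n = T 0 - T n"
proof (induction n)
  case (Suc n)
  then show ?case using T_rec[of n] D_eq[of "Suc n"] by (simp add: algebra_simps)
qed simp

lemma Nq_mono: "mono Nq"
  using b_nonneg Q_pos by (intro incseq_SucI) (simp add: less_imp_le)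

lemma Nq_nonneg: "0 \<le> Nq n"
  using monoD[OF Nq_mono, of 0 n] by simp

lemma Nq_ge_Q:
  assumes "1 \<le> l" "l \<le> n" "1 \<le> b l"
  shows "Q l \<le> Nq n"
proof -
  obtain k where k: "l = Suc k" using assms by (cases l) auto
  have "1 * Q l \<le> b l * Q l" using assms Q_bounds[of l] by (intro mult_right_mono) auto
  then show ?thesis using monoD[OF Nq_mono assms(2)] Nq_nonneg[of k] k by simp
qed

lemma Nq_unbounded: "\<exists>n. B < Nq n"
proof -
  obtain l where "nat B + 1 < l" "1 \<le> b l" using b_infinite by blast
  then show ?thesis using Nq_ge_Q[of l l] Q_ge[of l] by (intro exI[of _ l]) linarith
qed

section \<open>Lattice points relative to the two polygonal lines\<close>

lemma lattice_coordinates: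
  fixes q p :: int
  obtains i j where "q = Nq n + i * Q n + j * Q (Suc n)"
    "q * v 1 - p - T 0 = i * D n + j * D (Suc n) - T n"
proof -
  obtain i j where ij: "q - Nq n = i * Q n + j * Q (Suc n)"
    "p - Np n = i * numerator x n + j * numerator x (Suc n)" by (rule continuant_basis)
  have "real_of_int (q - Nq n) * v 1 - real_of_int (p - Np n) = i * D n + j * D (Suc n)"
    unfolding ij D_eq by (simp add: algebra_simps)
  then have "q * v 1 - p - T 0 = i * D n + j * D (Suc n) - T n"
    using Nq_point[of n] by (simp add: algebra_simps)
  then show ?thesis using ij by (intro that[of i j]) auto
qed

text \<open>The segment from vertex n to the next one has the direction of
  \<open>(Q (Suc n), D (Suc n))\<close>. A lattice point in its range has coordinate i at most 0 in
  the other basis direction, hence is at least as far from 0 as the segment, and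
  \<open>product_segment_ge\<close> applies.\<close>

lemma below_segment:
  fixes q p :: int
  assumes y: "q * v 1 - p - T 0 < 0" and q: "Nq n \<le> q" "q < Nq (Suc n)"
    and c: "0 \<le> c" "c \<le> Nq n * T n" "c \<le> Nq (Suc n) * T (Suc n)"
  shows "c \<le> q * \<bar>q * v 1 - p - T 0\<bar>"
proof -
  obtain i j where ij: "q = Nq n + i * Q n + j * Q (Suc n)"
    "q * v 1 - p - T 0 = i * D n + j * D (Suc n) - T n" by (rule lattice_coordinates)
  have Q: "0 \<le> Q n" "Q n < Q (Suc n)" using Q_bounds[of n] by auto
  \<comment> \<open>A positive i would give a value of at least \<open>D n - T n\<close>, putting
    the point on the other side. For negative j the condition \<open>Nq n \<le> q\<close> first
    forces \<open>i > - j\<close>.\<close>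
  have "i \<le> 0"
  proof (rule ccontr)
    assume i: "\<not> i \<le> 0"
    have "0 \<le> i * D n + j * D (Suc n) - T n"
    proof (cases "0 \<le> j")
      case True
      have "1 * D n \<le> i * D n" using i D_pos[of n] by (intro mult_right_mono) auto
      moreover have "0 \<le> j * D (Suc n)" using True D_pos[of "Suc n"] by simp
      ultimately show ?thesis using T_le_D[of n] by linarith
    next
      case False
      have "- j < i"
      proof (rule ccontr)
        assume "\<not> - j < i"
        then have "i * Q n \<le> - j * Q n" using Q by (intro mult_right_mono) auto
        moreover have "j * Q (Suc n) < j * Q n" using False Q by simp
        ultimately show False using ij q by simp
      qed
      then have "(1 - j) * D n \<le> i * D n" using D_pos[of n] by (intro mult_right_mono) auto
      moreover have "j * D n \<le> j * D (Suc n)" using False D_Suc_less[of n] by simp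
      ultimately show ?thesis using T_le_D[of n] by (simp add: algebra_simps)
    qed
    then show False using y ij by simp
  qed
  have b: "0 < b (Suc n)" using q Q b_nonneg[of "Suc n"] by (cases "b (Suc n) = 0") auto
  define l where "l = (q - Nq n) / (b (Suc n) * Q (Suc n))"
  have "real_of_int (q - Nq n) \<le> real_of_int (b (Suc n) * Q (Suc n))"
    unfolding of_int_le_iff using q by simp
  then have l: "0 \<le> l" "l \<le> 1" using b Q q by (auto simp: l_def divide_simps)
  have lq: "q - Nq n = l * (b (Suc n) * Q (Suc n))" using b Q by (simp add: l_def)
  have q_eq: "q = (1 - l) * Nq n + l * Nq (Suc n)" using lq by (simp add: algebra_simps)
  have y_ge: "(1 - l) * T n + l * T (Suc n) \<le> \<bar>q * v 1 - p - T 0\<bar>"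
  proof -
    have "i * real_of_int (Q n) + j * real_of_int (Q (Suc n)) = l * b (Suc n) * Q (Suc n)"
      using ij lq by simp
    \<comment> \<open>Multiplication by \<open>Q (Suc n)\<close> makes the determinant
      \<open>Q_D\<close> appear: the scaled offset from the segment is exactly i.\<close>
    then have "(i * D n + j * D (Suc n)) * Q (Suc n) =
        i * (Q (Suc n) * D n - Q n * D (Suc n)) + l * b (Suc n) * D (Suc n) * Q (Suc n)"
      by algebra
    then have "(i * D n + j * D (Suc n) - l * b (Suc n) * D (Suc n)) * Q (Suc n) = i"
      unfolding Q_D by (simp add: algebra_simps)
    then have "(i * D n + j * D (Suc n) - l * b (Suc n) * D (Suc n)) * Q (Suc n) \<le> 0"
      using \<open>i \<le> 0\<close> by simp
    then have "i * D n + j * D (Suc n) \<le> l * b (Suc n) * D (Suc n)"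
      using Q by (simp add: mult_le_0_iff)
    then show ?thesis using ij y T_rec[of n] by (simp add: algebra_simps)
  qed
  have c_le: "c \<le> ((1 - l) * Nq n + l * Nq (Suc n)) * ((1 - l) * T n + l * T (Suc n))"
    using c l T_nonneg Nq_nonneg[of n] Nq_nonneg[of "Suc n"]
    by (intro product_segment_ge) (auto simp del: Nq_simps)
  have q0: "0 \<le> real_of_int q" using q Nq_nonneg[of n] by simp
  note c_le
  also note mult_left_mono[OF y_ge q0, unfolded q_eq]
  finally show ?thesis unfolding q_eq .
qed

text \<open>Counterpart of \<open>below_segment\<close> on the other side. Consecutive upper
  vertices differ by \<open>b (Suc n) + 1\<close> times the second basis vector minus the first, so
  the side of the segment is decided by the sign of the determinant
  \<open>j + (b (Suc n) + 1) * i\<close>.\<close>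

lemma above_segment:
  fixes q p :: int
  defines "X \<equiv> \<lambda>n. Nq n + Q n"
  assumes y: "0 \<le> q * v 1 - p - T 0" and q: "X n \<le> q" "q < X (Suc n)"
    and c: "0 \<le> c" "c \<le> X n * (D n - T n)" "c \<le> X (Suc n) * (D (Suc n) - T (Suc n))"
  shows "c \<le> q * \<bar>q * v 1 - p - T 0\<bar>"
proof -
  obtain i' j where ij': "q = Nq n + i' * Q n + j * Q (Suc n)"
    "q * v 1 - p - T 0 = i' * D n + j * D (Suc n) - T n" by (rule lattice_coordinates)
  \<comment> \<open>The upper vertex is the lower one moved by \<open>(Q n, D n)\<close>, hence the
    shift of the first coordinate by one.\<close>
  define i where "i = i' - 1"
  have ij: "q = X n + i * Q n + j * Q (Suc n)"
    "q * v 1 - p - T 0 = i * D n + j * D (Suc n) + (D n - T n)"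
    using ij' by (auto simp: X_def i_def algebra_simps)
  have Q: "0 \<le> Q n" "Q n < Q (Suc n)" using Q_bounds[of n] by auto
  let ?b = "b (Suc n)"
  have b: "0 \<le> ?b" by (rule b_nonneg)
  have X_Suc: "X (Suc n) = X n + (?b + 1) * Q (Suc n) - Q n" by (simp add: X_def algebra_simps)
  \<comment> \<open>For negative i, the bound on q gives \<open>j \<le> b (Suc n) + k\<close>, while
    nonnegativity of the value demands \<open>j * D (Suc n) \<ge> k * D n + T n\<close>. These
    conflict because \<open>T (Suc n)\<close> is positive.\<close>
  have "0 \<le> i"
  proof (rule ccontr)
    assume neg: "\<not> 0 \<le> i"
    define k where "k = - 1 - i"
    have k: "0 \<le> k" "i = - 1 - k" using neg by (auto simp: k_def)
    have 1: "(j - ?b - 1) * Q (Suc n) < k * Q n"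
      using q ij X_Suc unfolding k by (simp add: algebra_simps)
    have "j - ?b - 1 < k"
    proof (rule ccontr)
      assume "\<not> j - ?b - 1 < k"
      then have "k * Q (Suc n) \<le> (j - ?b - 1) * Q (Suc n)" using Q by (intro mult_right_mono) auto
      moreover have "k * Q n \<le> k * Q (Suc n)" using Q k by (intro mult_left_mono) auto
      ultimately show False using 1 by linarith
    qed
    then have "j * D (Suc n) \<le> (?b + k) * D (Suc n)"
      using D_pos[of "Suc n"] by (intro mult_right_mono) auto
    moreover have "k * D (Suc n) \<le> k * D n"
      using k D_Suc_less[of n] by (intro mult_left_mono) auto
    moreover have "k * D n + T n \<le> j * D (Suc n)"
      using y unfolding ij(2) k(2) by (simp add: algebra_simps)
    ultimately show False using T_rec[of n] T_pos[of "Suc n"] by (simp add: algebra_simps)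
  qed
  \<comment> \<open>A negative determinant would place q to the left of \<open>X n\<close>.\<close>
  have above: "0 \<le> j + (?b + 1) * i"
  proof (rule ccontr)
    assume "\<not> ?thesis"
    then have "j * Q (Suc n) \<le> (- 1 - (?b + 1) * i) * Q (Suc n)" using Q by (intro mult_right_mono) auto
    moreover have "i * Q n \<le> i * Q (Suc n)" using Q \<open>0 \<le> i\<close> by (intro mult_left_mono) auto
    moreover have "0 \<le> ?b * i * Q (Suc n)" using b Q \<open>0 \<le> i\<close> by simp
    ultimately show False using q ij Q by (simp add: algebra_simps)
  qed
  have "1 * Q (Suc n) \<le> (?b + 1) * Q (Suc n)" using b Q by (intro mult_right_mono) auto
  then have dX: "0 < X (Suc n) - X n" using X_Suc Q by linarith
  define l where "l = real_of_int (q - X n) / (X (Suc n) - X n)"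
  have l: "0 \<le> l" "l \<le> 1" using dX q by (auto simp: l_def divide_simps)
  have lq: "q - X n = l * (X (Suc n) - X n)" using dX by (simp add: l_def)
  have q_eq: "q = (1 - l) * X n + l * X (Suc n)" using lq by (simp add: algebra_simps)
  have y_ge: "(1 - l) * (D n - T n) + l * (D (Suc n) - T (Suc n)) \<le> \<bar>q * v 1 - p - T 0\<bar>"
  proof -
    have dX': "real_of_int (X (Suc n) - X n) = (?b + 1) * Q (Suc n) - Q n"
      unfolding X_Suc by simp
    have "i * real_of_int (Q n) + j * real_of_int (Q (Suc n)) = l * ((?b + 1) * Q (Suc n) - real_of_int (Q n))"
      using lq ij X_Suc by simp
    then have "(i * D n + j * D (Suc n) - l * ((?b + 1) * D (Suc n) - D n)) *
        ((?b + 1) * Q (Suc n) - real_of_int (Q n)) =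
        (j + (real_of_int ?b + 1) * i) * (Q (Suc n) * D n - Q n * D (Suc n))"
      unfolding of_int_add of_int_mult of_int_1 by algebra
    also have "\<dots> = real_of_int (j + (?b + 1) * i)" unfolding Q_D by simp
    also have "0 \<le> \<dots>" unfolding of_int_0_le_iff by (rule above)
    finally have "0 \<le> (i * D n + j * D (Suc n) - l * ((?b + 1) * D (Suc n) - D n)) *
        ((?b + 1) * Q (Suc n) - real_of_int (Q n))" .
    moreover have "0 < (?b + 1) * Q (Suc n) - real_of_int (Q n)" using dX dX' by linarith
    ultimately have "0 \<le> i * D n + j * D (Suc n) - l * ((?b + 1) * D (Suc n) - D n)"
      by (simp add: zero_le_mult_iff)
    then show ?thesis using ij y T_rec[of n] by (simp add: algebra_simps)
  qed
  have X: "0 \<le> X n" for n unfolding X_def using Nq_nonneg[of n] Q_bounds[of n] by simp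
  from X have c_le: "c \<le> ((1 - l) * X n + l * X (Suc n)) *
      ((1 - l) * (D n - T n) + l * (D (Suc n) - T (Suc n)))"
    using c l T_le_D[of n] T_le_D[of "Suc n"] by (intro product_segment_ge) auto
  have q0: "0 \<le> real_of_int q" using q X[of n] by simp
  note c_le
  also note mult_left_mono[OF y_ge q0, unfolded q_eq]
  finally show ?thesis unfolding q_eq .
qed

text \<open>The condition on q puts it to the right of vertex m on both lines, so only products with
  index at least m enter.\<close>

lemma approximation_lower_bound:
  fixes q p :: int
  assumes c: "0 \<le> c" "\<And>n. m \<le> n \<Longrightarrow> c \<le> Nq n * T n" "\<And>n. m \<le> n \<Longrightarrow> c \<le> (Nq n + Q n) * (D n - T n)"
    and q: "Nq m + Q m \<le> q"
  shows "c \<le> q * \<bar>q * v 1 - p - T 0\<bar>"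
proof (cases "q * v 1 - p - T 0 < 0")
  case True
  have "Nq m \<le> q" using q Q_bounds[of m] by simp
  from unbounded_bracket[OF this Nq_unbounded Nq_mono] obtain n where
    "m \<le> n" "Nq n \<le> q" "q < Nq (Suc n)" .
  then show ?thesis using c True by (intro below_segment[of q p n]) (auto simp del: Nq_simps)
next
  case False
  have "\<exists>n. B < Nq n + Q n" for B
  proof -
    obtain n where "B < Nq n" using Nq_unbounded by auto
    then show ?thesis using Q_bounds[of n] by (intro exI[of _ n]) simp
  qed
  moreover have "mono (\<lambda>n. Nq n + Q n)"
    using Q_bounds Nq_mono by (intro incseq_SucI add_mono) (auto simp: less_imp_le incseq_SucD simp del: Nq_simps)
  ultimately obtain n where "m \<le> n" "Nq n + Q n \<le> q" "q < Nq (Suc n) + Q (Suc n)"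
    using unbounded_bracket[of "\<lambda>n. Nq n + Q n" m q] q by blast
  then show ?thesis using c False by (intro above_segment[of q p n]) (auto simp del: Nq_simps)
qed

section \<open>Lower bounds for the products at the vertices\<close>

lemma Nq_T_lower:
  assumes "1 \<le> l" "l \<le> n" "n < m" "m \<le> l + Z + 1" "1 \<le> b l" "1 \<le> b m"
  shows "1 / of_int M ^ (Z + 2) \<le> Nq n * T n"
proof -
  have M: "1 \<le> real_of_int M" using M_ge by simp
  \<comment> \<open>The nonzero digit at l controls the first coordinate and the one at m the
    second. Each index in between costs a factor M, in total \<open>m + 1 - l \<le> Z + 2\<close> of
    them.\<close>
  have 1: "Q (Suc n) / of_int M ^ (Suc n - l) \<le> Nq n"
    using Q_lower[of l "Suc n"] Nq_ge_Q[of l n] assms by (simp del: continuant.simps)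
  have 2: "D n / of_int M ^ (m - n) \<le> T n"
    using D_add_bounds(1)[of n "m - n"] T_ge_D[of n m] assms by simp
  have "1 / of_int M ^ (Z + 2) \<le> (1 :: real) / of_int M ^ ((Suc n - l) + (m - n))"
    using M assms by (intro divide_left_mono power_increasing) auto
  also have "\<dots> \<le> Q (Suc n) * D n / of_int M ^ ((Suc n - l) + (m - n))"
    using QD_ge_1[of n] M by (intro divide_right_mono) auto
  also have "\<dots> = (Q (Suc n) / of_int M ^ (Suc n - l)) * (D n / of_int M ^ (m - n))"
    by (simp add: power_add)
  also have "\<dots> \<le> Nq n * T n"
    using 1 2 D_pos[of n] M Nq_nonneg[of n] by (intro mult_mono) auto
  finally show ?thesis .
qed

text \<open>At an upper vertex \<open>Q n\<close> alone is large enough, by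
  \<open>theta_lower'\<close>, and \<open>gap_lower\<close> bounds the other coordinate. The
  numerator M cancels one factor of \<open>M ^ (Z + 1)\<close>.\<close>

lemma gap_product_lower:
  assumes "2 \<le> n"
  shows "(1 - R) / (of_int M ^ Z * ((of_int M)\<^sup>2 - 1)) \<le> (Nq n + Q n) * (D n - T n)"
proof -
  have M: "3 \<le> real_of_int M" using M_ge by simp
  obtain j where j: "j \<le> Suc n + Z" "n < j" "(1 - R) * D j \<le> D n - T n" by (rule gap_lower)
  have "real_of_int M * real_of_int M \<ge> 3 * 3" using M by (intro mult_mono) auto
  then have M2: "0 < (of_int M)\<^sup>2 - (1::real)" by (simp add: power2_eq_square)
  have "of_int M / ((of_int M)\<^sup>2 - 1) \<le> theta n"
    using theta_lower'[of "n - 2"] assms by (simp add: numeral_2_eq_2 Suc_diff_Suc)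
  then have "of_int M / ((of_int M)\<^sup>2 - 1) * Q (Suc n) \<le> theta n * Q (Suc n)"
    using Q_pos[of n] by (intro mult_right_mono) auto
  also have "\<dots> = Q n" using Q_pos[of n] by (simp add: theta_def)
  also have "\<dots> \<le> Nq n + Q n" using Nq_nonneg[of n] by simp
  finally have 1: "of_int M / ((of_int M)\<^sup>2 - 1) * Q (Suc n) \<le> Nq n + Q n" .
  have "D n / of_int M ^ (Suc Z) \<le> D n / of_int M ^ (j - n)"
    using M j D_pos[of n] by (intro divide_left_mono power_increasing) auto
  also have "\<dots> \<le> D j" using D_add_bounds(1)[of n "j - n"] j by simp
  finally have "(1 - R) * (D n / of_int M ^ (Suc Z)) \<le> (1 - R) * D j"
    using R_bounds by (intro mult_left_mono) auto
  with j have 2: "(1 - R) * (D n / of_int M ^ (Suc Z)) \<le> D n - T n" by simp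
  have "(1 - R) / (of_int M ^ Z * ((of_int M)\<^sup>2 - 1)) \<le>
      (1 - R) / (of_int M ^ Z * ((of_int M)\<^sup>2 - 1)) * (Q (Suc n) * D n)"
    using QD_ge_1[of n] R_bounds M M2
      mult_left_mono[of 1 "Q (Suc n) * D n" "(1 - R) / (of_int M ^ Z * ((of_int M)\<^sup>2 - 1))"] by simp
  also have "\<dots> = (of_int M / ((of_int M)\<^sup>2 - 1) * Q (Suc n)) * ((1 - R) * (D n / of_int M ^ (Suc Z)))"
    using M by (simp add: mult_ac)
  also have "\<dots> \<le> (Nq n + Q n) * (D n - T n)"
    using 1 2 R_bounds D_pos[of n] M Nq_nonneg[of n] Q_bounds[of n] by (intro mult_mono) auto
  finally show ?thesis .
qed

lemma Nq_T_const:
  assumes "n \<le> m" "\<And>l. n < l \<Longrightarrow> l \<le> m \<Longrightarrow> b l = 0"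
  shows "Nq m = Nq n" "T m = T n"
proof -
  have "Nq m = Nq n \<and> T m = T n" using assms
  proof (induction rule: dec_induct)
    case (step k)
    then have "b (Suc k) = 0" by auto
    then show ?case using step T_rec[of k] by auto
  qed simp
  then show "Nq m = Nq n" "T m = T n" by auto
qed

text \<open>All indices from one nonzero digit up to just before the next share the same vertex.
  Either these two digits are close and \<open>Nq_T_lower\<close> applies, or the zeros between them
  are numerous enough to meet the exceptional set C.\<close>

lemma Nq_T_eq_or_lower:
  assumes n: "1 \<le> l0" "l0 \<le> n" "1 \<le> b l0"
    and zero_run: "\<And>k. l0 < k \<Longrightarrow> \<forall>j\<le>Z. b (k + j) = 0 \<Longrightarrow> \<exists>m\<in>C. k \<le> Suc m \<and> m \<le> k + Z"
  shows "(\<exists>m\<in>C. Nq n * T n = Nq m * T m) \<or> 1 / of_int M ^ (Z + 2) \<le> Nq n * T n"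
proof -
  define l where "l = (GREATEST l. l \<le> n \<and> 1 \<le> b l)"
  have l: "l \<le> n" "1 \<le> b l" unfolding l_def using GreatestI_nat[of "\<lambda>l. l \<le> n \<and> 1 \<le> b l" l0 n] n by auto
  have lz: "b k = 0" if "l < k" "k \<le> n" for k
    using Greatest_le_nat[of "\<lambda>l. l \<le> n \<and> 1 \<le> b l" k n] that b_nonneg[of k] unfolding l_def[symmetric]
    by fastforce
  have "l0 \<le> l" unfolding l_def using n by (intro Greatest_le_nat[of _ _ n]) auto
  define m where "m = (LEAST m. n < m \<and> 1 \<le> b m)"
  have m: "n < m" "1 \<le> b m" using LeastI_ex[of "\<lambda>m. n < m \<and> 1 \<le> b m"] b_infinite[of n] unfolding m_def by auto
  have mz: "b k = 0" if "n < k" "k < m" for k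
    using not_less_Least[of k "\<lambda>m. n < m \<and> 1 \<le> b m"] that b_nonneg[of k] unfolding m_def[symmetric] by fastforce
  have z: "b k = 0" if "l < k" "k < m" for k
    using that lz mz by (cases "k \<le> n") auto
  show ?thesis
  proof (cases "m \<le> l + Z + 1")
    case True
    then show ?thesis using l m \<open>l0 \<le> l\<close> n by (intro disjI2 Nq_T_lower[of l n m]) auto
  next
    case False
    then have "\<forall>j\<le>Z. b (Suc l + j) = 0" using z by auto
    \<comment> \<open>The index from C may precede the run by one place, since l already carries the
      vertex shared by the run.\<close>
    from zero_run[OF _ this] \<open>l0 \<le> l\<close> obtain k where k: "k \<in> C" "l \<le> k" "k \<le> Suc l + Z" by auto
    have "Nq k = Nq l" "T k = T l" using k False z by (intro Nq_T_const; auto)+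
    moreover have "Nq n = Nq l" "T n = T l" using l m z by (intro Nq_T_const; auto)+
    ultimately show ?thesis using k by (intro disjI1 bexI[of _ k]) auto
  qed
qed

end

section \<open>Davenport coefficients\<close>

text \<open>The excluded pattern \<open>x i - 1, x l - 2, ..., x l - 2, x j - 1\<close> is symmetric
  under reversal, which later allows the digits of e to be read backwards.\<close>

definition admissible :: "(nat \<Rightarrow> int) \<Rightarrow> (nat \<Rightarrow> int) \<Rightarrow> bool" where
  "admissible x c \<longleftrightarrow> (\<forall>k\<ge>1. 0 \<le> c k \<and> c k \<le> x k - 1) \<and>
     (\<forall>i\<ge>1. \<forall>j>i. c i = x i - 1 \<longrightarrow> (\<forall>l. i < l \<and> l < j \<longrightarrow> c l = x l - 2) \<longrightarrow> c j \<noteq> x j - 1)"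

lemma admissibleD:
  assumes "admissible x c"
  shows "1 \<le> k \<Longrightarrow> 0 \<le> c k" "1 \<le> k \<Longrightarrow> c k \<le> x k - 1"
    "1 \<le> i \<Longrightarrow> i < j \<Longrightarrow> c i = x i - 1 \<Longrightarrow> (\<And>l. i < l \<Longrightarrow> l < j \<Longrightarrow> c l = x l - 2) \<Longrightarrow> c j \<noteq> x j - 1"
  using assms unfolding admissible_def by blast+

context bounded_ncf
begin

lemma ncf_rem_1: "1 \<le> i \<Longrightarrow> ncf_rem (v 1) i = v i"
  using ncf_rem_value[of 1 "i - 1"] by simp

lemma ncf_digit_1: "1 \<le> i \<Longrightarrow> ncf_digit (v 1) i = x i"
  using ncf_digit_value[of 1 "i - 1"] by simp

lemma ncf_D_1: "ncf_D (v 1) n = D n"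
  using ncf_D_value[of 1 n] by (simp add: D_def)

lemmas ncf_at_1 [simp] = ncf_rem_1[unfolded One_nat_def] ncf_digit_1[unfolded One_nat_def]

context
  fixes y :: real and c d
  assumes y: "0 \<le> y" "y < 1"
  defines "c \<equiv> dav_coeff (v 1) y" and "d \<equiv> dav_rem (v 1) y"
begin

lemma dav_step: "1 \<le> i \<Longrightarrow> d i = v i * (c i + d (Suc i))"
proof -
  assume "1 \<le> i"
  then obtain k where k: "i = Suc k" by (cases i) auto
  then show ?thesis using v_lower[of i] by (simp add: c_def d_def dav_coeff_def)
qed

lemma dav_rem_range: "0 \<le> d i" "d i < 1"
proof -
  have "0 \<le> d i \<and> d i < 1"
  proof (cases "i \<le> 1")
    case True
    then show ?thesis using y by (cases i) (auto simp: d_def)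
  next
    case False
    then obtain k where "i = Suc (Suc k)" by (metis One_nat_def not0_implies_Suc not_less_eq_eq le0)
    then show ?thesis by (simp add: d_def) linarith
  qed
  then show "0 \<le> d i" "d i < 1" by auto
qed

lemma dav_coeff_less:
  assumes i: "1 \<le> i"
  shows "0 \<le> c i" "c i \<le> x i - 1" "d i < 1 - v i \<Longrightarrow> c i \<le> x i - 2"
proof -
  have eq: "c i + d (Suc i) = d i / v i" "x i - v (Suc i) = 1 / v i"
    using dav_step[OF i] v_step'[OF i] v_lower[OF i] by (auto simp: field_simps)
  have "c i = \<lfloor>d i / v i\<rfloor>" using i by (simp add: c_def d_def dav_coeff_def)
  then show "0 \<le> c i" using v_lower[OF i] dav_rem_range(1)[of i] by simp
  have "d i / v i < 1 / v i" using dav_rem_range(2)[of i] v_lower[OF i] by (intro divide_strict_right_mono) auto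
  then have "real_of_int (c i) < x i" using eq dav_rem_range(1)[of "Suc i"] v_lower(2)[of "Suc i"] by simp
  then show "c i \<le> x i - 1" by linarith
  assume "d i < 1 - v i"
  then have "d i / v i < (1 - v i) / v i" using v_lower[OF i] by (intro divide_strict_right_mono) auto
  also have "\<dots> = 1 / v i - 1" using v_lower[OF i] by (simp add: diff_divide_distrib)
  finally have "real_of_int (c i) < x i - 1"
    using eq dav_rem_range(1)[of "Suc i"] v_lower(2)[of "Suc i"] by simp
  then show "c i \<le> x i - 2" by linarith
qed

text \<open>A maximal digit forces the next remainder below \<open>1 - v\<close>, and digits
  \<open>x l - 2\<close> preserve this. By \<open>dav_coeff_less\<close> no maximal digit can then
  follow.\<close>

lemma dav_rem_after_max:
  assumes "1 \<le> i" "c i = x i - 1" "i < j" "\<And>l. i < l \<Longrightarrow> l < j \<Longrightarrow> c l = x l - 2"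
  shows "d j < 1 - v j"
proof -
  have eq: "c k + d (Suc k) = d k * (x k - v (Suc k))" if "1 \<le> k" for k
    using dav_step[OF that] v_step'[OF that] v_lower[OF that] by algebra
  have inv: "1 < x k - v (Suc k)" if "1 \<le> k" for k
    using v_step'[OF that] v_lower[OF that] by (smt (verit) mult_left_le)
  from assms(3)[THEN Suc_leI] assms(4) show ?thesis
  proof (induction rule: dec_induct)
    case base
    have "d i * (x i - v (Suc i)) < 1 * (x i - v (Suc i))"
      using dav_rem_range(2)[of i] inv[OF assms(1)] by (intro mult_strict_right_mono) auto
    then show ?case using eq[OF assms(1)] assms(2) by simp
  next
    case (step k)
    then have k: "d k < 1 - v k" "c k = x k - 2" "1 \<le> k" by auto
    have "d k * (x k - v (Suc k)) < (1 - v k) * (x k - v (Suc k))"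
      using k inv[of k] by (intro mult_strict_right_mono) auto
    also have "\<dots> = (x k - v (Suc k)) - 1" using v_step'[of k] k by (simp add: algebra_simps)
    finally show ?case using eq[of k] k by simp
  qed
qed

lemma dav_admissible: "admissible x c"
  unfolding admissible_def
proof (intro conjI allI impI)
  fix i j assume *: "1 \<le> i" "i < j" "c i = x i - 1" "\<forall>l. i < l \<and> l < j \<longrightarrow> c l = x l - 2"
  then have "d j < 1 - v j" by (intro dav_rem_after_max) auto
  then show "c j \<noteq> x j - 1" using dav_coeff_less(3)[of j] * by auto
qed (use dav_coeff_less in auto)

lemma dav_sums: "(\<lambda>k. of_int (c (Suc k)) * D (Suc k)) sums y"
proof -
  \<comment> \<open>After n digits the error is \<open>D n\<close> times the next remainder, hence
    at most \<open>R ^ n\<close>.\<close>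
  have part: "y = (\<Sum>k<n. of_int (c (Suc k)) * D (Suc k)) + D n * d (Suc n)" for n
  proof (induction n)
    case 0
    then show ?case by (simp add: d_def)
  next
    case (Suc n)
    then show ?case using dav_step[of "Suc n"] by (simp add: D_Suc algebra_simps)
  qed
  have "(\<lambda>n. R ^ n) \<longlonglongrightarrow> 0" using R_bounds by (intro LIMSEQ_realpow_zero) auto
  then have "(\<lambda>n. D n * d (Suc n)) \<longlonglongrightarrow> 0"
  proof (rule Lim_null_comparison[rotated])
    show "\<forall>\<^sub>F n in sequentially. norm (D n * d (Suc n)) \<le> R ^ n"
    proof (intro always_eventually allI)
      fix n
      have "D n * d (Suc n) \<le> R ^ n * 1"
        using D_le[of n] D_pos[of n] dav_rem_range[of "Suc n"] R_bounds by (intro mult_mono) auto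
      then show "norm (D n * d (Suc n)) \<le> R ^ n"
        using D_pos[of n] dav_rem_range[of "Suc n"] by (simp add: abs_mult)
    qed
  qed
  then have "(\<lambda>n. y - D n * d (Suc n)) \<longlonglongrightarrow> y - 0" by (intro tendsto_intros)
  moreover have "(\<Sum>k<n. of_int (c (Suc k)) * D (Suc k)) = y - D n * d (Suc n)" for n
    using part[of n] by simp
  ultimately show ?thesis unfolding sums_def by simp
qed

end

text \<open>Beyond \<open>Suc m\<close> the new digits are never maximal, so a forbidden pattern
  ends at \<open>Suc m\<close> or earlier. Ending at \<open>Suc m\<close> it would come from a
  forbidden pattern of c ending at m, whose digit was lowered by one. The case \<open>m = 0\<close>
  serves the endpoint 1.\<close>

lemma replace_tail_admissible:
  assumes c: "admissible x c" and m: "m = 0 \<or> 1 \<le> c m"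
  shows "admissible x (replace_tail (v 1) m c)"
proof -
  let ?c = "replace_tail (v 1) m c"
  have val: "?c k = c k" if "k < m" for k using that by (simp add: replace_tail_def)
  have vm: "?c m = c m - 1" by (simp add: replace_tail_def)
  have vS: "?c (Suc m) = x (Suc m) - 1" by (simp add: replace_tail_def)
  have vl: "?c k = x k - 2" if "Suc m < k" for k using that by (simp add: replace_tail_def)
  have bounds: "0 \<le> ?c k \<and> ?c k \<le> x k - 1" if k: "1 \<le> k" for k
  proof -
    consider "k < m" | "k = m" | "k = Suc m" | "Suc m < k" by linarith
    then show ?thesis
      using admissibleD(1,2)[OF c k] digit_ge[OF k] m k val vm vS vl by cases auto
  qed
  have "?c j \<noteq> x j - 1"
    if ij: "1 \<le> i" "i < j" "?c i = x i - 1" "\<forall>l. i < l \<and> l < j \<longrightarrow> ?c l = x l - 2" for i j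
  proof
    assume cj: "?c j = x j - 1"
    have "j \<le> Suc m" using cj vl[of j] by force
    then have "i \<le> m" using ij by simp
    have "c m \<le> x m - 1" using \<open>i \<le> m\<close> ij admissibleD(2)[OF c, of m] by simp
    then have "i < m" using \<open>i \<le> m\<close> ij vm by (cases "i = m") auto
    then have ci: "c i = x i - 1" using ij val by simp
    have "j \<noteq> m" using cj vm \<open>c m \<le> x m - 1\<close> by auto
    consider "j < m" | "j = Suc m" using \<open>j \<le> Suc m\<close> \<open>j \<noteq> m\<close> by linarith
    then show False
    proof cases
      case 1
      then show ?thesis using admissibleD(3)[OF c ij(1,2) ci] ij(4) val cj by auto
    next
      case 2
      then have "c m = x m - 1" using ij(4) vm \<open>i < m\<close> by force
      moreover have "c l = x l - 2" if "i < l" "l < m" for l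
        using ij(4)[rule_format, of l] val[of l] that 2 by simp
      ultimately show ?thesis using admissibleD(3)[OF c ij(1) \<open>i < m\<close> ci] by blast
    qed
  qed
  then show ?thesis unfolding admissible_def using bounds by blast
qed

lemma E_repr_admissible: "E_repr (v 1) y c \<Longrightarrow> admissible x c"
  unfolding E_repr_def
proof (elim disjE conjE exE)
  assume "c = replace_tail (v 1) 0 (\<lambda>k. if k = 0 then 1 else 0)"
  moreover have "admissible x (\<lambda>k. if k = 0 then 1 else 0)"
    using digit_ge by (force simp: admissible_def)
  ultimately show ?thesis using replace_tail_admissible by blast
qed (use dav_admissible replace_tail_admissible in auto)

lemma E_setE:
  assumes "y \<in> E_set (v 1) s"
  obtains c where "admissible x c" "(\<lambda>k. of_int (c (Suc k)) * D (Suc k)) sums y"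
    "\<And>i::nat. 1 \<le> i \<Longrightarrow> \<exists>j\<le>s. c (i + j) \<noteq> 0"
    "\<And>i. 1 \<le> i \<Longrightarrow> c (i + s) = x (i + s) - 1 \<Longrightarrow> \<exists>j<s. c (i + j) \<noteq> x (i + j) - 2"
proof -
  obtain c where c: "E_repr (v 1) y c" "(\<lambda>k. of_int (c (Suc k)) * D (Suc k)) sums y"
    "\<not> (\<exists>i\<ge>1. \<forall>j\<le>s. c (i + j) = 0)"
    "\<not> (\<exists>i\<ge>1. (\<forall>j<s. c (i + j) = ncf_digit (v 1) (i + j) - 2) \<and>
      c (i + s) = ncf_digit (v 1) (i + s) - 1)"
    using assms unfolding E_set_def ncf_D_1 by auto
  show ?thesis
  proof (rule that)
    fix i :: nat assume i: "1 \<le> i"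
    show "\<exists>j\<le>s. c (i + j) \<noteq> 0" using c(3) i by blast
    assume "c (i + s) = x (i + s) - 1"
    then have "\<exists>j<s. c (i + j) \<noteq> ncf_digit (v 1) (i + j) - 2" using c(4) i by fastforce
    then show "\<exists>j<s. c (i + j) \<noteq> x (i + j) - 2" using i by simp
  qed (use c E_repr_admissible in auto)
qed

lemma F_setE:
  assumes "y \<in> F_set (v 1) s"
  obtains c where "admissible x c" "(\<lambda>k. of_int (c (Suc k)) * D (Suc k)) sums y"
    "\<And>i::nat. 1 \<le> i \<Longrightarrow> \<exists>j\<le>s. c (i + j) \<noteq> 0"
    "\<And>i. 1 \<le> i \<Longrightarrow> c i = x i - 1 \<Longrightarrow> \<exists>j\<in>{1..s}. c (i + j) \<noteq> x (i + j) - 2"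
proof -
  have y: "0 \<le> y" "y < 1" using assms by (auto simp: F_set_def)
  let ?c = "dav_coeff (v 1) y"
  have c: "\<not> (\<exists>i\<ge>1. \<forall>j\<le>s. ?c (i + j) = 0)"
    "\<not> (\<exists>i\<ge>1. ?c i = ncf_digit (v 1) i - 1 \<and>
      (\<forall>j\<in>{1..s}. ?c (i + j) = ncf_digit (v 1) (i + j) - 2))"
    using assms unfolding F_set_def by blast+
  show ?thesis
  proof (rule that)
    fix i :: nat assume i: "1 \<le> i"
    show "\<exists>j\<le>s. ?c (i + j) \<noteq> 0" using c(1) i by blast
    assume "?c i = x i - 1"
    then have "\<exists>j\<in>{1..s}. ?c (i + j) \<noteq> ncf_digit (v 1) (i + j) - 2" using c(2) i by fastforce
    then show "\<exists>j\<in>{1..s}. ?c (i + j) \<noteq> x (i + j) - 2" using i by simp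
  qed (use dav_admissible[OF y] dav_sums[OF y] in auto)
qed

end

section \<open>The digit sequence\<close>

text \<open>Around \<open>\<kappa> i\<close> the digits of x agree with y to the left and with z to
  the right, on windows of growing length. The digits f start r places later, hence refer to z
  shifted by r.\<close>

locale block_digits = bounded_ncf x M N for x M N +
  fixes y z e f :: "nat \<Rightarrow> int" and r s :: nat and \<kappa> u w :: "nat \<Rightarrow> nat"
  assumes N_le_s: "N \<le> s" and N_le_r: "N \<le> r"
    and left_digits: "1 \<le> j \<Longrightarrow> j \<le> u i \<Longrightarrow> x (\<kappa> i + 1 - j) = y j"
    and right_digits: "1 \<le> j \<Longrightarrow> j \<le> r + w i \<Longrightarrow> x (\<kappa> i + j) = z j"
    and spacing: "\<kappa> i + r + w i + N + u (Suc i) < \<kappa> (Suc i)" "u 0 \<le> \<kappa> 0"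
    and u_ge: "i < u i" and w_ge: "i < w i"
    and e_u: "e (u i) \<noteq> 0" and f_w: "f (w i) \<noteq> 0"
    and e_adm: "admissible y e" and f_adm: "admissible (\<lambda>i. z (i + r)) f"
    and e_zero: "1 \<le> i \<Longrightarrow> \<exists>j\<le>s. e (i + j) \<noteq> 0"
    and f_zero: "1 \<le> i \<Longrightarrow> \<exists>j\<le>s. f (i + j) \<noteq> 0"
    and e_max: "1 \<le> i \<Longrightarrow> e (i + s) = y (i + s) - 1 \<Longrightarrow> \<exists>j<s. e (i + j) \<noteq> y (i + j) - 2"
    and f_max: "1 \<le> i \<Longrightarrow> f i = z (i + r) - 1 \<Longrightarrow> \<exists>j\<in>{1..s}. f (i + j) \<noteq> z (i + j + r) - 2"
begin

definition block_end :: "nat \<Rightarrow> nat" where "block_end i = \<kappa> i + r + w i + N"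

text \<open>The gap in front of a block is counted to that block, so every position has exactly one
  index.\<close>

definition block_index :: "nat \<Rightarrow> nat" where "block_index k = (LEAST i. k \<le> block_end i)"

text \<open>Block \<open>i\<close> carries the digits \<open>e\<close>, read backwards from position \<open>\<kappa> i\<close>, then \<open>r\<close> zeros, then
  the digits \<open>f\<close>, then \<open>N\<close> zeros. Both words are cut at a nonzero digit, so the zero runs of
  different pieces do not join, and the final zeros contain a position with partial quotient at least 3,
  which stops a block \<open>x l - 2, x l - 2, \<dots>\<close> running out of \<open>f\<close>.\<close>

definition b :: "nat \<Rightarrow> int" where
  "b k = (let i = block_index k in
     if k + u i \<le> \<kappa> i then (if 3 \<le> x k then 1 else 0)
     else if k \<le> \<kappa> i then e (\<kappa> i + 1 - k)
     else if k \<le> \<kappa> i + r then 0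
     else if k \<le> \<kappa> i + r + w i then f (k - \<kappa> i - r)
     else 0)"

section \<open>Locating a position within the blocks\<close>

lemma u_le_\<kappa>: "u i \<le> \<kappa> i"
proof (cases i)
  case (Suc n)
  then show ?thesis using spacing(1)[of n] by simp
qed (use spacing in simp)

lemma block_end_less: "i < i' \<Longrightarrow> block_end i + u i' < \<kappa> i'"
proof (induction i')
  case (Suc i')
  have "block_end i' + u (Suc i') < \<kappa> (Suc i')" using spacing(1)[of i'] by (simp add: block_end_def)
  moreover have "block_end i \<le> block_end i'" if "i < i'" using Suc.IH[OF that] by (simp add: block_end_def)
  ultimately show ?case using Suc.prems by (cases "i = i'") auto
qed simp

lemma \<kappa>_ge: "i \<le> \<kappa> i - u i"
proof (induction i)
  case (Suc i)
  have "block_end i + u (Suc i) < \<kappa> (Suc i)" by (rule block_end_less) simp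
  then show ?case using Suc by (simp add: block_end_def)
qed simp

lemma block_index_props: "k \<le> block_end (block_index k)" "i < block_index k \<Longrightarrow> block_end i < k"
proof -
  have "k \<le> block_end k" using \<kappa>_ge[of k] by (simp add: block_end_def)
  then show "k \<le> block_end (block_index k)" unfolding block_index_def by (rule LeastI)
  show "block_end i < k" if "i < block_index k"
    using not_less_Least[of i "\<lambda>i. k \<le> block_end i"] that by (simp add: block_index_def not_le)
qed

lemma block_index_eq:
  assumes "k \<le> block_end i" "\<And>i'. i' < i \<Longrightarrow> block_end i' < k"
  shows "block_index k = i"
  unfolding block_index_def using assms by (intro Least_equality) (auto simp: not_le[symmetric])

lemma block_index_block:
  assumes "\<kappa> i < k + u i" "k \<le> block_end i"
  shows "block_index k = i"
  using assms block_end_less[of _ i] by (intro block_index_eq) fastforce+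

lemma b_left: "1 \<le> j \<Longrightarrow> j \<le> u i \<Longrightarrow> b (\<kappa> i + 1 - j) = e j"
  using block_index_block[of i "\<kappa> i + 1 - j"] u_le_\<kappa>[of i] by (auto simp: b_def Let_def block_end_def)

lemma b_zero: "1 \<le> j \<Longrightarrow> j \<le> r \<Longrightarrow> b (\<kappa> i + j) = 0"
  using block_index_block[of i "\<kappa> i + j"] by (auto simp: b_def Let_def block_end_def)

lemma b_right: "1 \<le> j \<Longrightarrow> j \<le> w i \<Longrightarrow> b (\<kappa> i + r + j) = f j"
  using block_index_block[of i "\<kappa> i + r + j"] by (auto simp: b_def Let_def block_end_def)

lemma b_tail: "1 \<le> j \<Longrightarrow> j \<le> N \<Longrightarrow> b (\<kappa> i + r + w i + j) = 0"
  using block_index_block[of i "\<kappa> i + r + w i + j"] by (auto simp: b_def Let_def block_end_def)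

text \<open>The filler between blocks is never maximal, and it has no N consecutive zeros, because
  its ones sit where the partial quotient is at least 3.\<close>

lemma b_fill:
  assumes "k + u i \<le> \<kappa> i" "\<And>i'. i' < i \<Longrightarrow> block_end i' < k"
  shows "b k = (if 3 \<le> x k then 1 else 0)"
proof -
  have "block_index k = i" using assms by (intro block_index_eq) (auto simp: block_end_def)
  then show ?thesis using assms by (simp add: b_def)
qed

lemma position_cases:
  assumes "1 \<le> k"
  obtains (left) i j where "k = \<kappa> i + 1 - j" "1 \<le> j" "j \<le> u i"
  | (zero) i j where "k = \<kappa> i + j" "1 \<le> j" "j \<le> r"
  | (right) i j where "k = \<kappa> i + r + j" "1 \<le> j" "j \<le> w i"
  | (tail) i j where "k = \<kappa> i + r + w i + j" "1 \<le> j" "j \<le> N"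
  | (fill) i where "k + u i \<le> \<kappa> i" "\<And>i'. i' < i \<Longrightarrow> block_end i' < k"
proof -
  define i where "i = block_index k"
  have i: "k \<le> block_end i" "\<And>i'. i' < i \<Longrightarrow> block_end i' < k"
    unfolding i_def by (rule block_index_props)+
  consider "k + u i \<le> \<kappa> i" | "\<kappa> i < k + u i" "k \<le> \<kappa> i" | "\<kappa> i < k" "k \<le> \<kappa> i + r"
    | "\<kappa> i + r < k" "k \<le> \<kappa> i + r + w i" | "\<kappa> i + r + w i < k" by linarith
  then show ?thesis
  proof cases
    case 1 then show ?thesis using i fill by blast
  next
    case 2 then show ?thesis using left[of i "\<kappa> i + 1 - k"] assms by simp
  next
    case 3 then show ?thesis using zero[of i "k - \<kappa> i"] by simp
  next
    case 4 then show ?thesis using right[of i "k - \<kappa> i - r"] by simp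
  next
    case 5 then show ?thesis using tail[of i "k - \<kappa> i - r - w i"] i by (simp add: block_end_def)
  qed
qed

lemma b_nonneg: "0 \<le> b k"
proof (cases "1 \<le> k")
  case True
  then show ?thesis
  proof (cases rule: position_cases)
    case (left i j)
    then show ?thesis using b_left admissibleD(1)[OF e_adm] by simp
  next
    case (right i j)
    then show ?thesis using b_right admissibleD(1)[OF f_adm] by simp
  qed (simp_all add: b_zero b_tail b_fill)
next
  case False
  then have k: "k = 0" by simp
  have "b 0 = (if 3 \<le> x 0 then 1 else 0)"
    using block_end_less u_le_\<kappa>[of 0] by (intro b_fill[of 0 0]) auto
  then show ?thesis using k by simp
qed

lemma b_le:
  assumes k: "1 \<le> k"
  shows "b k \<le> x k - 1"
  using k
proof (cases rule: position_cases)
  case (left i j)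
  then show ?thesis using b_left[of j i] left_digits[of j i] admissibleD(2)[OF e_adm, of j] by simp
next
  case (right i j)
  then show ?thesis
    using b_right[of j i] right_digits[of "r + j" i] admissibleD(2)[OF f_adm, of j] by (simp add: add_ac)
qed (use digit_ge[OF k] b_zero b_tail b_fill in auto)

section \<open>Breaks behind maximal digits and runs of zeros\<close>

lemma first_break:
  assumes "k < m" "m \<le> k + Z" "b m \<noteq> x m - 2"
    and "\<And>l. k < l \<Longrightarrow> l \<le> m \<Longrightarrow> (\<And>l'. k < l' \<Longrightarrow> l' < l \<Longrightarrow> b l' = x l' - 2) \<Longrightarrow> b l \<noteq> x l - 1"
  shows "\<exists>j. k < j \<and> j \<le> k + Z \<and> b j \<le> x j - 3 \<and> (\<forall>l. k < l \<and> l < j \<longrightarrow> b l = x l - 2)"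
proof -
  define j where "j = (LEAST j. k < j \<and> b j \<noteq> x j - 2)"
  have j: "k < j" "b j \<noteq> x j - 2"
    using LeastI[of "\<lambda>j. k < j \<and> b j \<noteq> x j - 2" m] assms unfolding j_def by auto
  have jm: "j \<le> m" unfolding j_def using assms by (intro Least_le) auto
  have l: "b l = x l - 2" if "k < l" "l < j" for l
    using not_less_Least[of l "\<lambda>j. k < j \<and> b j \<noteq> x j - 2"] that unfolding j_def[symmetric] by blast
  \<comment> \<open>The first digit different from \<open>x l - 2\<close> is not maximal, so it is
    smaller than \<open>x j - 2\<close>.\<close>
  have "b j \<noteq> x j - 1" using assms(4)[OF j(1) jm] l by blast
  then have "b j \<le> x j - 3" using j b_le[of j] by simp
  then show ?thesis using j jm l assms(2) by (intro exI[of _ j]) auto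
qed

text \<open>Moving right lowers the index in e, so the pattern appears reversed and is excluded by
  its symmetry; the r zeros behind it are not maximal.\<close>

lemma left_after_max:
  assumes j: "1 \<le> j" "j \<le> u i" "b (\<kappa> i + 1 - j) = x (\<kappa> i + 1 - j) - 1"
    and l: "\<kappa> i + 1 - j < l" "l \<le> \<kappa> i + r" "\<And>l'. \<kappa> i + 1 - j < l' \<Longrightarrow> l' < l \<Longrightarrow> b l' = x l' - 2"
  shows "b l \<noteq> x l - 1"
proof (cases "l \<le> \<kappa> i")
  case True
  define h where "h = \<kappa> i + 1 - l"
  have h: "1 \<le> h" "h < j" "l = \<kappa> i + 1 - h" using True l(1) j u_le_\<kappa>[of i] by (auto simp: h_def)
  have dig: "b (\<kappa> i + 1 - m) = e m" "x (\<kappa> i + 1 - m) = y m" if "1 \<le> m" "m \<le> j" for m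
    using b_left[of m i] left_digits[of m i] that j by auto
  show ?thesis
  proof
    assume "b l = x l - 1"
    then have eh: "e h = y h - 1" using dig[of h] h by simp
    have "e m = y m - 2" if "h < m" "m < j" for m
    proof -
      have "b (\<kappa> i + 1 - m) = x (\<kappa> i + 1 - m) - 2"
        using that h j u_le_\<kappa>[of i] by (intro l(3)) auto
      then show ?thesis using dig[of m] that by simp
    qed
    then have "e j \<noteq> y j - 1" using admissibleD(3)[OF e_adm h(1,2) eh] by blast
    then show False using dig[of j] j by simp
  qed
next
  case False
  then have "b l = 0" using b_zero[of "l - \<kappa> i" i] l by simp
  then show ?thesis using digit_ge[of l] False by simp
qed

lemma right_after_max:
  assumes j: "1 \<le> j" "j \<le> w i" "b (\<kappa> i + r + j) = x (\<kappa> i + r + j) - 1"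
    and l: "\<kappa> i + r + j < l" "l \<le> \<kappa> i + r + w i + N"
      "\<And>l'. \<kappa> i + r + j < l' \<Longrightarrow> l' < l \<Longrightarrow> b l' = x l' - 2"
  shows "b l \<noteq> x l - 1"
proof (cases "l \<le> \<kappa> i + r + w i")
  case True
  define h where "h = l - \<kappa> i - r"
  have h: "j < h" "h \<le> w i" "l = \<kappa> i + r + h" using True l(1) by (auto simp: h_def)
  have dig: "b (\<kappa> i + r + m) = f m" "x (\<kappa> i + r + m) = z (m + r)" if "1 \<le> m" "m \<le> w i" for m
    using b_right[of m i] right_digits[of "r + m" i] that by (auto simp: add_ac)
  have fj: "f j = z (j + r) - 1" using dig[of j] j by simp
  have "f m = z (m + r) - 2" if "j < m" "m < h" for m
  proof -
    have "b (\<kappa> i + r + m) = x (\<kappa> i + r + m) - 2" using that h by (intro l(3)) auto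
    then show ?thesis using dig[of m] that h j by simp
  qed
  then have "f h \<noteq> z (h + r) - 1" using admissibleD(3)[OF f_adm j(1) h(1) fj] by blast
  then show ?thesis using dig[of h] h j by simp
next
  case False
  then have "b l = 0" using b_tail[of "l - \<kappa> i - r - w i" i] l by simp
  then show ?thesis using digit_ge[of l] False by simp
qed

lemma b_break:
  assumes k: "1 \<le> k" and bk: "b k = x k - 1"
  shows "\<exists>j. k < j \<and> j \<le> k + (s + N - 1) \<and> b j \<le> x j - 3 \<and> (\<forall>l. k < l \<and> l < j \<longrightarrow> b l = x l - 2)"
  using k
proof (cases rule: position_cases)
  case (left i j)
  have dig: "b (\<kappa> i + 1 - m) = e m" "x (\<kappa> i + 1 - m) = y m" if "1 \<le> m" "m \<le> j" for m
    using b_left[of m i] left_digits[of m i] that left by auto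
  show ?thesis
  proof (cases "s < j")
    case True
    have "e (j - s + s) = y (j - s + s) - 1" using dig[of j] left bk True by simp
    moreover have "1 \<le> j - s" using True by simp
    ultimately obtain h where h: "h < s" "e (j - s + h) \<noteq> y (j - s + h) - 2" using e_max by blast
    show ?thesis
    proof (rule first_break[of k "\<kappa> i + 1 - (j - s + h)"])
      show "b (\<kappa> i + 1 - (j - s + h)) \<noteq> x (\<kappa> i + 1 - (j - s + h)) - 2"
        using dig[of "j - s + h"] h True by simp
      show "b l \<noteq> x l - 1" if "k < l" "l \<le> \<kappa> i + 1 - (j - s + h)"
        "\<And>l'. k < l' \<Longrightarrow> l' < l \<Longrightarrow> b l' = x l' - 2" for l
        using that left True bk by (intro left_after_max[of j i l]) auto
    qed (use left h True u_le_\<kappa>[of i] N_pos in auto)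
  next
    case False
    \<comment> \<open>Here the run may outlast the digits of e. Among the zeros behind them one has
      partial quotient at least 3 and breaks it, at distance \<open>j + h \<le> s + N - 1\<close>
      from k.\<close>
    obtain h where h: "h < N" "3 \<le> x (\<kappa> i + 1 + h)" using no_twos[of "\<kappa> i + 1"] by auto
    have "b (\<kappa> i + 1 + h) = 0" using b_zero[of "Suc h" i] h N_le_r by simp
    show ?thesis
    proof (rule first_break[of k "\<kappa> i + 1 + h"])
      show "b (\<kappa> i + 1 + h) \<noteq> x (\<kappa> i + 1 + h) - 2" using h \<open>b (\<kappa> i + 1 + h) = 0\<close> by simp
      show "b l \<noteq> x l - 1" if "k < l" "l \<le> \<kappa> i + 1 + h"
        "\<And>l'. k < l' \<Longrightarrow> l' < l \<Longrightarrow> b l' = x l' - 2" for l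
        using that left h N_le_r bk by (intro left_after_max[of j i l]) auto
    qed (use left h False u_le_\<kappa>[of i] N_pos in auto)
  qed
next
  case (right i j)
  have dig: "b (\<kappa> i + r + m) = f m" "x (\<kappa> i + r + m) = z (m + r)" if "1 \<le> m" "m \<le> w i" for m
    using b_right[of m i] right_digits[of "r + m" i] that by (auto simp: add_ac)
  have "f j = z (j + r) - 1" using dig[of j] right bk by simp
  with f_max[OF right(2)] obtain h where h: "1 \<le> h" "h \<le> s" "f (j + h) \<noteq> z (j + h + r) - 2" by auto
  show ?thesis
  proof (cases "j + h \<le> w i")
    case True
    show ?thesis
    proof (rule first_break[of k "k + h"])
      show "b (k + h) \<noteq> x (k + h) - 2" using dig[of "j + h"] h True right by (simp add: add_ac)
      show "b l \<noteq> x l - 1" if "k < l" "l \<le> k + h"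
        "\<And>l'. k < l' \<Longrightarrow> l' < l \<Longrightarrow> b l' = x l' - 2" for l
        using that right True bk by (intro right_after_max[of j i l]) auto
    qed (use h N_pos in auto)
  next
    case False
    let ?p = "\<kappa> i + r + w i + 1"
    \<comment> \<open>The break promised by \<open>f_max\<close> lies beyond the cut, so the N zeros
      after f must supply one; \<open>j + h > w i\<close> keeps the distance within
      \<open>s + N - 1\<close>.\<close>
    obtain g where g: "g < N" "3 \<le> x (?p + g)" using no_twos[of ?p] by auto
    have "b (?p + g) = 0" using b_tail[of "Suc g" i] g by simp
    show ?thesis
    proof (rule first_break[of k "?p + g"])
      show "b (?p + g) \<noteq> x (?p + g) - 2" using g \<open>b (?p + g) = 0\<close> by simp
      show "b l \<noteq> x l - 1" if "k < l" "l \<le> ?p + g"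
        "\<And>l'. k < l' \<Longrightarrow> l' < l \<Longrightarrow> b l' = x l' - 2" for l
        using that right g bk by (intro right_after_max[of j i l]) auto
    qed (use g h False right N_pos in auto)
  qed
qed (use digit_ge[OF k] bk in \<open>auto simp: b_zero b_tail b_fill split: if_splits\<close>)

text \<open>If the filler ends before its next one, the block that follows begins with
  \<open>e (u i)\<close>, which is nonzero.\<close>

lemma fill_nonzero:
  assumes p: "1 \<le> p" "p + u i \<le> \<kappa> i + 1" "\<And>i'. i' < i \<Longrightarrow> block_end i' < p"
  shows "\<exists>j<N. b (p + j) \<noteq> 0"
proof -
  obtain g where g: "g < N" "3 \<le> x (p + g)" using no_twos[OF p(1)] by auto
  show ?thesis
  proof (cases "p + g + u i \<le> \<kappa> i")
    case True
    then have "b (p + g) = 1"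
      using b_fill[of "p + g" i] p(3) g by (simp add: less_le_trans trans_less_add1)
    then show ?thesis using g by (intro exI[of _ g]) simp
  next
    case False
    have "b (\<kappa> i + 1 - u i) = e (u i)" using u_ge[of i] by (intro b_left) auto
    moreover have "p + (\<kappa> i + 1 - u i - p) = \<kappa> i + 1 - u i" using p(2) by simp
    ultimately show ?thesis using e_u[of i] g False by (intro exI[of _ "\<kappa> i + 1 - u i - p"]) auto
  qed
qed

text \<open>Within e, within f and in the filler a nonzero digit comes too soon for such a run; only
  the r zeros, possibly together with neighbouring zeros of e, can accommodate it.\<close>

lemma zero_run:
  assumes k: "1 \<le> k" and zero: "\<forall>j\<le>s + N - 1. b (k + j) = 0"
  shows "\<exists>m\<in>{\<kappa> i + j |i j. j \<le> r}. k \<le> Suc m \<and> m \<le> k + (s + N - 1)"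
proof -
  have sN: "s \<le> s + N - 1" "2 * N - 1 \<le> s + N - 1" using N_pos N_le_s by auto
  show ?thesis
    using k
  proof (cases rule: position_cases)
    case (left i j)
    show ?thesis
    proof (cases "s < j")
      case True
      then have "1 \<le> j - s" by simp
      from e_zero[OF this] obtain h where h: "h \<le> s" "e (j - s + h) \<noteq> 0" by auto
      have "b (\<kappa> i + 1 - (j - s + h)) = e (j - s + h)" using True left h by (intro b_left) auto
      moreover have "\<kappa> i + 1 - (j - s + h) = k + (s - h)" using True left h u_le_\<kappa>[of i] by simp
      ultimately have False using zero h sN by (metis diff_le_self order_trans)
      then show ?thesis ..
    next
      case False
      have "\<kappa> i + 1 \<in> {\<kappa> i + j |i j. j \<le> r}" using N_le_r N_pos by fastforce
      then show ?thesis using False left sN u_le_\<kappa>[of i]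
        by (intro bexI[of _ "\<kappa> i + 1"]) auto
    qed
  next
    case (zero i j)
    then show ?thesis by (intro bexI[of _ k]) auto
  next
    case (right i j)
    from f_zero[OF right(2)] obtain h where h: "h \<le> s" "f (j + h) \<noteq> 0" by auto
    have "\<exists>h\<le>s. j + h \<le> w i \<and> f (j + h) \<noteq> 0"
    proof (cases "j + h \<le> w i")
      case False
      then show ?thesis using h f_w[of i] right by (intro exI[of _ "w i - j"]) auto
    qed (use h in auto)
    then obtain h where h: "h \<le> s" "j + h \<le> w i" "f (j + h) \<noteq> 0" by auto
    then have "b (k + h) \<noteq> 0" using b_right[of "j + h" i] right by (simp add: add_ac)
    then show ?thesis using zero h sN by (meson order_trans)
  next
    case (tail i j)
    let ?p = "block_end i + 1"
    have "block_end i' < ?p" if "i' < Suc i" for i'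
      using that block_end_less[of i' i] by (cases "i' = i") (auto simp: block_end_def)
    moreover have "?p + u (Suc i) \<le> \<kappa> (Suc i) + 1" using block_end_less[of i "Suc i"] by simp
    \<comment> \<open>The N zeros after f can be prolonged by at most N - 1 zeros of what follows,
      and \<open>2 * N - 1 \<le> s + N - 1\<close>.\<close>
    ultimately obtain g where g: "g < N" "b (?p + g) \<noteq> 0" using fill_nonzero[of ?p "Suc i"] by auto
    have "?p + g = k + (N - j + 1 + g)" using tail by (simp add: block_end_def)
    moreover have "N - j + 1 + g \<le> s + N - 1" using tail g N_le_s by simp
    ultimately show ?thesis using g zero by metis
  next
    case (fill i)
    then obtain g where "g < N" "b (k + g) \<noteq> 0" using fill_nonzero[of k i] k by auto
    then show ?thesis using zero sN N_le_s by auto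
  qed
qed

lemma b_infinite: "\<exists>k>n. 1 \<le> b k"
proof -
  let ?k = "\<kappa> n + 1 - u n"
  have "b ?k = e (u n)" using u_ge[of n] by (intro b_left) auto
  then have "1 \<le> b ?k" using e_u[of n] b_nonneg[of ?k] by simp
  moreover have "n < ?k" using \<kappa>_ge[of n] u_le_\<kappa>[of n] by simp
  ultimately show ?thesis by blast
qed

lemma digit_expansion: "digit_expansion x M N b (s + N - 1)"
  by unfold_locales (use b_nonneg b_le b_break b_infinite in blast)+

end

section \<open>Limits along the blocks\<close>

locale block_limits = block_digits +
  fixes Ey Ez :: real
  assumes y_bounded: "bounded_ncf y M N" and z_bounded: "bounded_ncf z M N"
    and e_sums: "(\<lambda>k. of_int (e (Suc k)) * bounded_ncf.D y (Suc k)) sums Ey"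
    and f_sums: "(\<lambda>k. of_int (f (Suc k)) * (\<Prod>i<Suc k. ncf_value z (Suc (r + i)))) sums Ez"
begin

interpretation Y: bounded_ncf y M N by (rule y_bounded)
interpretation Z: bounded_ncf z M N by (rule z_bounded)
sublocale digit_expansion x M N b "s + N - 1" by (rule digit_expansion)

lemma eventually_u_ge: "eventually (\<lambda>i. n \<le> u i) sequentially"
  using u_ge by (intro eventually_sequentiallyI[of n]) (meson le_less_trans less_imp_le)

lemma eventually_w_ge: "eventually (\<lambda>i. n \<le> w i) sequentially"
  using w_ge by (intro eventually_sequentiallyI[of n]) (meson le_less_trans less_imp_le)

text \<open>\<open>theta\<close> reads x backwards from \<open>\<kappa> i\<close>, where it agrees
  with y, so \<open>window_limit\<close> applies to y.\<close>

lemma theta_limit: "(\<lambda>i. theta (\<kappa> i - j)) \<longlonglongrightarrow> ncf_value y (Suc j)"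
proof -
  have "(\<lambda>i. theta (\<kappa> i - (j + 0))) \<longlonglongrightarrow> ncf_value y (Suc j)"
  proof (rule Y.window_limit[where h = "\<lambda>i n. theta (\<kappa> i - (j + n))"])
    fix n
    show "\<forall>\<^sub>F k in sequentially. \<forall>i<n. theta (\<kappa> k - (j + i)) =
        1 / (y (Suc j + i) - theta (\<kappa> k - (j + Suc i)))"
      using eventually_u_ge[of "Suc j + n"]
    proof eventually_elim
      case (elim k)
      have "theta (\<kappa> k - (j + i)) = 1 / (y (Suc j + i) - theta (\<kappa> k - (j + Suc i)))" if "i < n" for i
      proof -
        have "\<kappa> k - (j + i) = Suc (\<kappa> k - (j + Suc i))" using elim that u_le_\<kappa>[of k] by simp
        moreover have "x (\<kappa> k + 1 - (Suc j + i)) = y (Suc j + i)"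
          using elim that by (intro left_digits) auto
        ultimately show ?thesis using theta_Suc[of "\<kappa> k - (j + Suc i)"] by simp
      qed
      then show ?case by blast
    qed
    show "\<forall>\<^sub>F k in sequentially. \<forall>i\<le>n. 0 \<le> theta (\<kappa> k - (j + i)) \<and> theta (\<kappa> k - (j + i)) \<le> R"
      using theta_range theta_le_R by (intro always_eventually) blast
  qed simp
  then show ?thesis by simp
qed

lemma v_limit:
  assumes "1 \<le> j"
  shows "(\<lambda>i. v (\<kappa> i + j)) \<longlonglongrightarrow> ncf_value z j"
proof -
  have "(\<lambda>i. v (\<kappa> i + j + 0)) \<longlonglongrightarrow> ncf_value z j"
  proof (rule Z.window_limit[where h = "\<lambda>i n. v (\<kappa> i + j + n)"])
    fix n
    show "\<forall>\<^sub>F k in sequentially. \<forall>i<n. v (\<kappa> k + j + i) =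
        1 / (z (j + i) - v (\<kappa> k + j + Suc i))"
      using eventually_w_ge[of "j + n"]
    proof eventually_elim
      case (elim k)
      have "v (\<kappa> k + j + i) = 1 / (z (j + i) - v (\<kappa> k + j + Suc i))" if "i < n" for i
        using v_step[of "\<kappa> k + j + i"] right_digits[of "j + i" k] elim that assms by (simp add: add_ac)
      then show ?case by blast
    qed
    show "\<forall>\<^sub>F k in sequentially. \<forall>i\<le>n. 0 \<le> v (\<kappa> k + j + i) \<and> v (\<kappa> k + j + i) \<le> R"
      using v_range assms by (intro always_eventually) (simp add: trans_le_add1 trans_le_add2)
  qed (rule assms)
  then show ?thesis by simp
qed

lemma b_bound: "1 \<le> k \<Longrightarrow> \<bar>real_of_int (b k)\<bar> \<le> M"
  using b_nonneg[of k] b_le[of k] digit_le[of k] by simp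

lemma geometric_summable: "summable (\<lambda>k. of_int M * R ^ k)"
  using R_bounds by (intro summable_mult summable_geometric) auto

text \<open>Divided by \<open>Q (Suc (\<kappa> i))\<close>, the sum taken backwards has terms
  \<open>b (\<kappa> i - k)\<close> times a product of ratios \<open>theta\<close>, which tend to
  the terms of the expansion of e. The majorant \<open>M * R ^ k\<close> permits Tannery's
  theorem.\<close>

lemma Nq_limit: "(\<lambda>i. Nq (\<kappa> i) / Q (Suc (\<kappa> i))) \<longlonglongrightarrow> Ey"
proof -
  define g where "g k i = b (\<kappa> i - k) * (\<Prod>m<Suc k. theta (\<kappa> i - m))" for k i
  \<comment> \<open>The factor \<open>theta 0 = 0\<close> cuts the series off, so the finite sum can
    be treated as an infinite one.\<close>
  have g_zero: "g k i = 0" if "\<kappa> i \<le> k" for k i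
    using that by (auto simp: g_def intro!: bexI[of _ "\<kappa> i"])
  have Nq_eq: "Nq (\<kappa> i) / Q (Suc (\<kappa> i)) = (\<Sum>k. g k i)" for i
  proof -
    have "(\<Sum>k. g k i) = (\<Sum>k<\<kappa> i. g k i)"
      using g_zero by (intro suminf_finite) auto
    also have "\<dots> = (\<Sum>k<\<kappa> i. b (\<kappa> i - k) * Q (\<kappa> i - k)) / Q (Suc (\<kappa> i))"
      unfolding sum_divide_distrib of_int_sum of_int_mult
    proof (rule sum.cong)
      fix k assume k: "k \<in> {..<\<kappa> i}"
      have "real_of_int (Q (Suc (\<kappa> i) - Suc k)) =
          Q (Suc (\<kappa> i)) * (\<Prod>m<Suc k. theta (Suc (\<kappa> i) - Suc m))"
        using k by (intro Q_diff) auto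
      then show "g k i = real_of_int (b (\<kappa> i - k)) * real_of_int (Q (\<kappa> i - k)) / real_of_int (Q (Suc (\<kappa> i)))"
        using Q_pos[of "\<kappa> i"] unfolding g_def diff_Suc_Suc by (simp del: prod.lessThan_Suc)
    qed simp
    also have "(\<Sum>k<\<kappa> i. b (\<kappa> i - k) * Q (\<kappa> i - k)) = Nq (\<kappa> i)"
      unfolding Nq_def
      by (subst sum.nat_diff_reindex[symmetric]) (auto intro!: sum.cong simp: Suc_diff_Suc)
    finally show ?thesis by simp
  qed
  have "((\<lambda>i. suminf (\<lambda>k. g k i)) \<longlongrightarrow> (\<Sum>k. of_int (e (Suc k)) * Y.D (Suc k))) sequentially"
  proof (rule tannerys_theorem[where a = g and M = "\<lambda>k. of_int M * R ^ k", THEN conjunct2, THEN conjunct2])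
    show "((\<lambda>i. g k i) \<longlongrightarrow> of_int (e (Suc k)) * Y.D (Suc k)) sequentially" for k
      unfolding g_def Y.D_def
    proof (intro tendsto_mult tendsto_prod theta_limit)
      show "(\<lambda>i. real_of_int (b (\<kappa> i - k))) \<longlonglongrightarrow> of_int (e (Suc k))"
      proof (rule tendsto_eventually)
        show "\<forall>\<^sub>F i in sequentially. real_of_int (b (\<kappa> i - k)) = of_int (e (Suc k))"
          using eventually_u_ge[of "Suc k"]
        proof eventually_elim
          case (elim i)
          then show ?case using b_left[of "Suc k" i] by simp
        qed
      qed
    qed
    have "norm (g k i) \<le> of_int M * R ^ k" for k i
    proof (cases "\<kappa> i \<le> k")
      case True
      then show ?thesis using g_zero M_ge R_bounds by simp
    next
      case False
      have "(\<Prod>m<Suc k. theta (\<kappa> i - m)) \<le> (\<Prod>m<Suc k. R)"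
        using theta_range theta_le_R by (intro prod_mono) auto
      also have "\<dots> \<le> R ^ k" using power_decreasing[of k "Suc k" R] R_bounds by simp
      finally have "\<bar>of_int (b (\<kappa> i - k))\<bar> * (\<Prod>m<Suc k. theta (\<kappa> i - m)) \<le> of_int M * R ^ k"
        using b_bound[of "\<kappa> i - k"] False theta_range M_ge
        by (intro mult_mono) (auto intro!: prod_nonneg simp del: prod.lessThan_Suc)
      moreover have "0 \<le> (\<Prod>m<Suc k. theta (\<kappa> i - m))" using theta_range by (intro prod_nonneg) auto
      ultimately show ?thesis unfolding g_def by (simp add: abs_mult del: prod.lessThan_Suc)
    qed
    then show "\<forall>\<^sub>F (k, i) in sequentially \<times>\<^sub>F sequentially. norm (g k i) \<le> of_int M * R ^ k"
      by (intro always_eventually) auto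
  qed (use geometric_summable in auto)
  then show ?thesis unfolding Nq_eq using e_sums by (simp add: sums_iff)
qed

lemma T_limit: "(\<lambda>i. T (\<kappa> i + r) / D (\<kappa> i + r)) \<longlonglongrightarrow> Ez"
proof -
  define g where "g k i = b (\<kappa> i + r + Suc k) * (\<Prod>m<Suc k. v (Suc (\<kappa> i + r + m)))" for k i
  have T_eq: "T (\<kappa> i + r) / D (\<kappa> i + r) = (\<Sum>k. g k i)" for i
  proof -
    have "(\<lambda>k. of_int (b (Suc (\<kappa> i + r + k))) * D (Suc (\<kappa> i + r + k)) / D (\<kappa> i + r)) sums
        (T (\<kappa> i + r) / D (\<kappa> i + r))"
      unfolding T_def by (intro sums_divide summable_sums T_summable)
    moreover have "of_int (b (Suc (\<kappa> i + r + k))) * D (Suc (\<kappa> i + r + k)) / D (\<kappa> i + r) = g k i" for k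
      unfolding g_def using D_add[of "\<kappa> i + r" "Suc k"] D_pos[of "\<kappa> i + r"]
      by (simp del: prod.lessThan_Suc)
    ultimately show ?thesis by (simp add: sums_iff)
  qed
  have "((\<lambda>i. suminf (\<lambda>k. g k i)) \<longlongrightarrow>
      (\<Sum>k. of_int (f (Suc k)) * (\<Prod>i<Suc k. ncf_value z (Suc (r + i))))) sequentially"
  proof (rule tannerys_theorem[where a = g and M = "\<lambda>k. of_int M * R ^ k", THEN conjunct2, THEN conjunct2])
    show "((\<lambda>i. g k i) \<longlongrightarrow> of_int (f (Suc k)) * (\<Prod>i<Suc k. ncf_value z (Suc (r + i)))) sequentially" for k
      unfolding g_def
    proof (intro tendsto_mult tendsto_prod)
      show "(\<lambda>i. v (Suc (\<kappa> i + r + m))) \<longlonglongrightarrow> ncf_value z (Suc (r + m))" for m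
        using v_limit[of "Suc (r + m)"] by (simp add: add_ac)
      show "(\<lambda>i. real_of_int (b (\<kappa> i + r + Suc k))) \<longlonglongrightarrow> of_int (f (Suc k))"
      proof (rule tendsto_eventually)
        show "\<forall>\<^sub>F i in sequentially. real_of_int (b (\<kappa> i + r + Suc k)) = of_int (f (Suc k))"
          using eventually_w_ge[of "Suc k"]
        proof eventually_elim
          case (elim i)
          then show ?case using b_right[of "Suc k" i] by simp
        qed
      qed
    qed
    have "norm (g k i) \<le> of_int M * R ^ k" for k i
    proof -
      have P: "0 \<le> (\<Prod>m<Suc k. v (Suc (\<kappa> i + r + m)))" using v_range by (intro prod_nonneg) auto
      have "(\<Prod>m<Suc k. v (Suc (\<kappa> i + r + m))) \<le> (\<Prod>m<Suc k. R)"
        using v_range by (intro prod_mono) auto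
      also have "\<dots> \<le> R ^ k" using power_decreasing[of k "Suc k" R] R_bounds by simp
      finally have "\<bar>of_int (b (\<kappa> i + r + Suc k))\<bar> * (\<Prod>m<Suc k. v (Suc (\<kappa> i + r + m))) \<le> of_int M * R ^ k"
        using b_bound[of "\<kappa> i + r + Suc k"] M_ge P
        by (intro mult_mono) (auto simp del: prod.lessThan_Suc)
      then show ?thesis unfolding g_def using P by (simp add: abs_mult del: prod.lessThan_Suc)
    qed
    then show "\<forall>\<^sub>F (k, i) in sequentially \<times>\<^sub>F sequentially. norm (g k i) \<le> of_int M * R ^ k"
      by (intro always_eventually) auto
  qed (use geometric_summable in auto)
  then show ?thesis unfolding T_eq using f_sums by (simp add: sums_iff)
qed

text \<open>The scale \<open>Q (Suc (\<kappa> i)) * D (\<kappa> i)\<close> tends to the reciprocal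
  of the denominator, and the r zeros let T be evaluated at \<open>\<kappa> i + r\<close>, which
  produces the product of r tails.\<close>

lemma Nq_T_limit:
  "(\<lambda>i. Nq (\<kappa> i) * T (\<kappa> i)) \<longlonglongrightarrow>
    Ey * Ez * (\<Prod>j=1..r. ncf_value z j) / (1 - ncf_value y 1 * ncf_value z 1)"
proof -
  have "Nq (\<kappa> i) * T (\<kappa> i) =
      (Nq (\<kappa> i) / Q (Suc (\<kappa> i))) * (1 / (1 - theta (\<kappa> i) * v (Suc (\<kappa> i)))) *
      (\<Prod>j<r. v (\<kappa> i + Suc j)) * (T (\<kappa> i + r) / D (\<kappa> i + r))" for i
  proof -
    have "T (\<kappa> i + r) = T (\<kappa> i)"
    proof (rule Nq_T_const)
      show "b l = 0" if "\<kappa> i < l" "l \<le> \<kappa> i + r" for l using b_zero[of "l - \<kappa> i" i] that by simp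
    qed simp
    moreover have "1 / (1 - theta (\<kappa> i) * v (Suc (\<kappa> i))) = Q (Suc (\<kappa> i)) * D (\<kappa> i)"
      using QD_eq[of "\<kappa> i"] theta_v_bounds(3)[of "\<kappa> i"]
      by (metis less_irrefl nonzero_eq_divide_eq right_minus_eq)
    moreover have "(\<Prod>j<r. v (\<kappa> i + Suc j)) = D (\<kappa> i + r) / D (\<kappa> i)"
      using D_pos[of "\<kappa> i"] by (simp add: D_add)
    ultimately show ?thesis using D_pos[of "\<kappa> i + r"] D_pos[of "\<kappa> i"] Q_pos[of "\<kappa> i"] by simp
  qed
  moreover have "(\<lambda>i. (Nq (\<kappa> i) / Q (Suc (\<kappa> i))) * (1 / (1 - theta (\<kappa> i) * v (Suc (\<kappa> i)))) *
      (\<Prod>j<r. v (\<kappa> i + Suc j)) * (T (\<kappa> i + r) / D (\<kappa> i + r))) \<longlonglongrightarrow>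
      Ey * (1 / (1 - ncf_value y 1 * ncf_value z 1)) * (\<Prod>j<r. ncf_value z (Suc j)) * Ez"
  proof (intro tendsto_intros Nq_limit T_limit v_limit)
    show "(\<lambda>i. theta (\<kappa> i)) \<longlonglongrightarrow> ncf_value y 1" using theta_limit[of 0] by simp
    show "(\<lambda>i. v (Suc (\<kappa> i))) \<longlonglongrightarrow> ncf_value z 1" using v_limit[of 1] by simp
    have "ncf_value y 1 * ncf_value z 1 < 1 * 1"
      using Y.v_lower[of 1] Z.v_lower[of 1] by (intro mult_strict_mono) auto
    then show "1 - ncf_value y 1 * ncf_value z 1 \<noteq> 0" by simp
  qed simp
  moreover have "(\<Prod>j<r. ncf_value z (Suc j)) = (\<Prod>j=1..r. ncf_value z j)"
    by (simp add: prod.atLeast1_atMost_eq)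
  ultimately show ?thesis by (simp add: mult_ac)
qed

text \<open>The integers \<open>Nq (\<kappa> i)\<close> give the upper bound. For the lower one,
  vertices at the r zeros have products near V, and the smallness assumptions cover all other
  vertices.\<close>

lemma M_plus_eq:
  assumes V: "V = Ey * Ez * (\<Prod>j=1..r. ncf_value z j) / (1 - ncf_value y 1 * ncf_value z 1)"
    and small: "0 \<le> V" "V \<le> (1 - R) / (of_int M ^ (s + N - 1) * ((of_int M)\<^sup>2 - 1))"
      "V \<le> 1 / of_int M ^ (s + N - 1 + 2)"
  shows "M_plus (v 1) (T 0) = ereal V"
proof (rule antisym)
  have lim: "(\<lambda>i. Nq (\<kappa> i) * T (\<kappa> i)) \<longlonglongrightarrow> V" unfolding V by (rule Nq_T_limit)
  have value_eq: "real q * dist_nearest_int (real q * v 1 - T 0) =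
      real_of_int (int q) * \<bar>int q * v 1 - round (real q * v 1 - T 0) - T 0\<bar>" for q
    by (simp add: dist_nearest_int_def algebra_simps)
  show "M_plus (v 1) (T 0) \<le> ereal V"
  proof -
    have strict: "strict_mono \<kappa>"
    proof (rule strict_monoI)
      show "\<kappa> i < \<kappa> i'" if "i < i'" for i i' using block_end_less[OF that] by (simp add: block_end_def)
    qed
    have Nq_at: "filterlim (\<lambda>i. nat (Nq (\<kappa> i))) at_top sequentially"
    proof (rule filterlim_compose[of _ _ _ \<kappa>])
      show "filterlim \<kappa> at_top sequentially" using strict by (rule filterlim_subseq)
      show "filterlim (\<lambda>n. nat (Nq n)) at_top sequentially"
        unfolding filterlim_at_top
      proof
        fix m
        obtain n0 where "int m < Nq n0" using Nq_unbounded by blast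
        then show "\<forall>\<^sub>F n in sequentially. m \<le> nat (Nq n)"
          using monoD[OF Nq_mono, of n0] by (intro eventually_sequentiallyI[of n0]) fastforce
      qed
    qed
    have "ereal (real (nat (Nq n)) * dist_nearest_int (real (nat (Nq n)) * v 1 - T 0)) \<le> ereal (Nq n * T n)" for n
    proof -
      have "dist_nearest_int (Nq n * v 1 - T 0) \<le> \<bar>Nq n * v 1 - T 0 - Np n\<bar>"
        unfolding dist_nearest_int_def by (rule round_diff_minimal)
      also have "\<dots> = T n" using Nq_point[of n] T_nonneg[of n] by simp
      finally have "Nq n * dist_nearest_int (Nq n * v 1 - T 0) \<le> Nq n * T n"
        using Nq_nonneg[of n] by (intro mult_left_mono) auto
      then show ?thesis using Nq_nonneg[of n] by simp
    qed
    then have "Liminf sequentially (\<lambda>i. ereal (real (nat (Nq (\<kappa> i))) *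
        dist_nearest_int (real (nat (Nq (\<kappa> i))) * v 1 - T 0))) \<le>
        Liminf sequentially (\<lambda>i. ereal (Nq (\<kappa> i) * T (\<kappa> i)))"
      by (intro Liminf_mono always_eventually) blast
    also have "\<dots> = ereal V"
      using lim by (intro lim_imp_Liminf) auto
    finally have le: "Liminf sequentially (\<lambda>i. ereal (real (nat (Nq (\<kappa> i))) *
        dist_nearest_int (real (nat (Nq (\<kappa> i))) * v 1 - T 0))) \<le> ereal V" .
    have "M_plus (v 1) (T 0) \<le> Liminf sequentially (\<lambda>i. ereal (real (nat (Nq (\<kappa> i))) *
        dist_nearest_int (real (nat (Nq (\<kappa> i))) * v 1 - T 0)))"
      unfolding le_Liminf_iff
    proof (intro allI impI)
      fix c assume "c < M_plus (v 1) (T 0)"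
      then have "eventually (\<lambda>q. c < ereal (real q * dist_nearest_int (real q * v 1 - T 0))) sequentially"
        unfolding M_plus_def by (rule less_LiminfD)
      then show "\<forall>\<^sub>F i in sequentially. c < ereal (real (nat (Nq (\<kappa> i))) *
          dist_nearest_int (real (nat (Nq (\<kappa> i))) * v 1 - T 0))"
        using Nq_at by (rule eventually_compose_filterlim)
    qed
    with le show ?thesis by (rule order_trans[rotated])
  qed
  show "ereal V \<le> M_plus (v 1) (T 0)"
    unfolding M_plus_def
  proof (rule ereal_le_epsilon2)
    fix d :: real assume d: "0 < d"
    \<comment> \<open>\<open>approximation_lower_bound\<close> needs a nonnegative constant, hence
      the maximum with 0.\<close>
    define c where "c = max 0 (V - d)"
    have c: "0 \<le> c" "V - d \<le> c" "c \<le> V" using small d by (auto simp: c_def)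
    obtain i0 where i0: "\<And>i. i0 \<le> i \<Longrightarrow> c \<le> Nq (\<kappa> i) * T (\<kappa> i)"
    proof -
      have "\<forall>\<^sub>F i in sequentially. V - d < Nq (\<kappa> i) * T (\<kappa> i)"
        using lim d by (intro order_tendstoD) auto
      then obtain i0 where "\<And>i. i0 \<le> i \<Longrightarrow> V - d < Nq (\<kappa> i) * T (\<kappa> i)"
        unfolding eventually_sequentially by blast
      then show ?thesis using T_nonneg Nq_nonneg
        by (intro that[of i0]) (auto simp: c_def less_imp_le)
    qed
    \<comment> \<open>Starting at a nonzero digit beyond block i0 excludes the zero runs of earlier
      blocks, where the product need not be near V.\<close>
    obtain l0 where l0: "block_end i0 < l0" "1 \<le> b l0" using b_infinite by blast
    have A: "c \<le> Nq n * T n" if n: "l0 \<le> n" for n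
    proof -
      have run: "\<exists>m\<in>{\<kappa> i + j |i j. i0 \<le> i \<and> j \<le> r}. k \<le> Suc m \<and> m \<le> k + (s + N - 1)"
        if k: "l0 < k" "\<forall>j\<le>s + N - 1. b (k + j) = 0" for k
      proof -
        obtain i j where ij: "j \<le> r" "k \<le> Suc (\<kappa> i + j)" "\<kappa> i + j \<le> k + (s + N - 1)"
          using zero_run[OF _ k(2)] k(1) by auto
        have "i0 \<le> i"
        proof (rule ccontr)
          assume "\<not> i0 \<le> i"
          then have "block_end i < \<kappa> i0" using block_end_less[of i i0] by simp
          then show False using ij k l0 by (simp add: block_end_def)
        qed
        then show ?thesis using ij by blast
      qed
      have "(\<exists>m\<in>{\<kappa> i + j |i j. i0 \<le> i \<and> j \<le> r}. Nq n * T n = Nq m * T m) \<or>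
          1 / of_int M ^ (s + N - 1 + 2) \<le> Nq n * T n"
        using n l0 run by (intro Nq_T_eq_or_lower[of l0 n]) auto
      then show ?thesis
      proof
        assume "\<exists>m\<in>{\<kappa> i + j |i j. i0 \<le> i \<and> j \<le> r}. Nq n * T n = Nq m * T m"
        then obtain i j where ij: "i0 \<le> i" "j \<le> r" "Nq n * T n = Nq (\<kappa> i + j) * T (\<kappa> i + j)" by auto
        have z: "b l = 0" if "\<kappa> i < l" "l \<le> \<kappa> i + j" for l
          using b_zero[of "l - \<kappa> i" i] that ij(2) by simp
        have "Nq (\<kappa> i + j) = Nq (\<kappa> i)" "T (\<kappa> i + j) = T (\<kappa> i)"
          by (rule Nq_T_const[OF le_add1 z]; simp)+
        then show ?thesis using ij i0 by simp
      qed (use c small in auto)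
    qed
    have B: "c \<le> (Nq n + Q n) * (D n - T n)" if "2 \<le> n" for n
      using gap_product_lower[OF that] small c by linarith
    define m where "m = max l0 2"
    have low: "c \<le> real q * dist_nearest_int (real q * v 1 - T 0)" if "nat (Nq m + Q m) \<le> q" for q
      unfolding value_eq
      using that c A B Nq_nonneg[of m] Q_bounds[of m]
      by (intro approximation_lower_bound[of c m "int q"]) (auto simp: m_def)
    have "ereal (V - d) \<le> Liminf sequentially (\<lambda>q. ereal (real q * dist_nearest_int (real q * v 1 - T 0)))"
      using low c(2) by (intro Liminf_bounded eventually_sequentiallyI[of "nat (Nq m + Q m)"])
        (auto intro: order_trans)
    then show "ereal V \<le> Liminf sequentially (\<lambda>q. ereal (real q * dist_nearest_int (real q * v 1 - T 0))) + ereal d"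
      by (cases "Liminf sequentially (\<lambda>q. ereal (real q * dist_nearest_int (real q * v 1 - T 0)))") auto
  qed
qed

end

section \<open>Existence of the point\<close>

lemma ncf_value_shift: "ncf_value (\<lambda>i. x (i + m)) j = ncf_value x (j + m)"
proof -
  have "ncf_trunc (\<lambda>i. x (i + m)) n j = ncf_trunc x n (j + m)" for n j
    by (induction n arbitrary: j) auto
  then show ?thesis by (simp add: ncf_value_def)
qed

context bounded_ncf
begin

text \<open>Each condition involves finitely many consecutive digits and is symmetric under
  reversal, so it passes from windows of x to y.\<close>

lemma reversed_windows:
  assumes "\<And>n. \<exists>p\<ge>n. \<forall>j\<in>{1..n}. x (p + 1 - j) = y j"
  shows "bounded_ncf y M N"
proof
  fix j :: nat assume j: "1 \<le> j"
  obtain p where p: "j + N \<le> p" "\<And>i. 1 \<le> i \<Longrightarrow> i \<le> j + N \<Longrightarrow> x (p + 1 - i) = y i"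
    using assms[of "j + N"] by auto
  then show "2 \<le> y j" "y j \<le> M"
    using digit_ge[of "p + 1 - j"] digit_le[of "p + 1 - j"] p(2)[of j] j by auto
  have "1 \<le> p + 2 - j - N" using p(1) by simp
  from no_twos[OF this] obtain i where i: "i < N" "3 \<le> x (p + 2 - j - N + i)" by blast
  have "p + 2 - j - N + i = p + 1 - (j + (N - 1 - i))" using i p(1) by simp
  then have "3 \<le> y (j + (N - 1 - i))" using p(2)[of "j + (N - 1 - i)"] i j by simp
  then show "\<exists>i<N. 3 \<le> y (j + i)" using i by (intro exI[of _ "N - 1 - i"]) simp
qed

lemma forward_windows:
  assumes "\<And>n. \<exists>p. \<forall>j\<in>{1..n}. x (p + j) = z j"
  shows "bounded_ncf z M N"
proof
  fix j :: nat assume j: "1 \<le> j"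
  obtain p where "\<forall>i\<in>{1..j + N}. x (p + i) = z i" using assms by blast
  then have p: "1 \<le> i \<Longrightarrow> i \<le> j + N \<Longrightarrow> x (p + i) = z i" for i by simp
  show "2 \<le> z j" "z j \<le> M" using digit_ge[of "p + j"] digit_le[of "p + j"] p[of j] j by auto
  obtain i where i: "i < N" "3 \<le> x (p + j + i)" using no_twos[of "p + j"] j by auto
  then have "3 \<le> z (j + i)" using p[of "j + i"] j by (simp add: add_ac)
  then show "\<exists>i<N. 3 \<le> z (j + i)" using i by blast
qed

end

text \<open>The factors \<open>(1 - R) (1 - R\<^sup>2)\<close>, \<open>M^N\<close> and \<open>M\<^sup>2 - 1\<close> in the condition defining \<open>L\<close> are the losses in
  the lower bound for a best approximation away from the long zero blocks.\<close>

lemma zero_block_small: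
  fixes R M :: real and L :: int and N r s :: nat
  assumes R: "1 / 2 \<le> R" "R < 1" and M: "3 \<le> M" and N: "1 \<le> N" and s: "0 < s"
    and L: "R powi L \<le> (1 - R) * (1 - R\<^sup>2) / (M ^ N * (M\<^sup>2 - 1))"
    and r: "int s * L \<le> int r"
  shows "s \<le> r"
    and "R ^ r / (1 - R\<^sup>2) \<le> (1 - R) / (M ^ (s + N - 1) * (M\<^sup>2 - 1))"
    and "(1 - R) / (M ^ (s + N - 1) * (M\<^sup>2 - 1)) \<le> 1 / M ^ (s + N - 1 + 2)"
proof -
  define X where "X = (1 - R) * (1 - R\<^sup>2) / (M ^ N * (M\<^sup>2 - 1))"
  have M2: "9 \<le> M\<^sup>2" using power_mono[OF M, of 2] by simp
  have R2: "0 < 1 - R\<^sup>2" "1 - R\<^sup>2 \<le> 1" using R power_less_one_iff[of R 2] by auto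
  have num: "(1 - R) * (1 - R\<^sup>2) \<le> 1 * 1" using R R2 by (intro mult_mono) auto
  have "M ^ 1 * 1 \<le> M ^ N * (M\<^sup>2 - 1)" using M M2 N by (intro mult_mono power_increasing) auto
  then have XM: "X \<le> 1 / M" unfolding X_def using num M R R2 by (intro frac_le) auto
  then have X1: "X < 1" using M by (smt (verit) divide_less_eq_1_pos)
  have X0: "0 \<le> X" unfolding X_def using R R2 M M2 by (intro divide_nonneg_nonneg mult_nonneg_nonneg) auto
  \<comment> \<open>A negative exponent would make the power of R at least 1, whereas X is below
    1.\<close>
  have "0 \<le> L"
  proof (rule ccontr)
    assume "\<not> 0 \<le> L"
    then have "R powi L = inverse (R ^ nat (- L))" by (simp add: power_int_def power_inverse)
    moreover have "R ^ nat (- L) \<le> 1" "0 < R ^ nat (- L)" using R by (auto intro: power_le_one)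
    ultimately have "1 \<le> R powi L" by (simp add: one_le_inverse_iff)
    then show False using L X1 by (simp add: X_def)
  qed
  then obtain l where l: "L = int l" using nonneg_int_cases by blast
  have "l \<noteq> 0" using L X1 l by (cases "l = 0") (auto simp: X_def)
  then have "int s * 1 \<le> int s * L" unfolding l by (intro mult_left_mono) auto
  then show "s \<le> r" using r by simp
  have "R ^ r \<le> R ^ (l * s)" using r R unfolding l
    by (intro power_decreasing) (auto simp flip: of_nat_mult simp: mult.commute)
  also have "\<dots> = (R ^ l) ^ s" by (simp add: power_mult)
  also have "\<dots> \<le> X ^ s" using L R unfolding X_def l by (intro power_mono) auto
  finally have Rr: "R ^ r \<le> X ^ s" .
  obtain t where t: "s = Suc t" using s by (cases s) auto
  \<comment> \<open>One factor X is kept exactly; the other s - 1 are replaced by 1/M and raise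
    \<open>M ^ N\<close> to \<open>M ^ (s + N - 1)\<close>.\<close>
  have "X ^ t \<le> (1 / M) ^ t" using X0 XM by (intro power_mono) auto
  then have "X ^ s \<le> X * (1 / M) ^ t" using X0 t by (simp add: mult_left_mono)
  with Rr have "R ^ r \<le> X * (1 / M) ^ t" by simp
  then have "R ^ r / (1 - R\<^sup>2) \<le> X * (1 / M) ^ t / (1 - R\<^sup>2)" using R2 by (intro divide_right_mono) auto
  also have "\<dots> = (1 - R) / (M ^ (s + N - 1) * (M\<^sup>2 - 1))"
    using R2 t by (simp add: X_def power_add power_divide mult_ac)
  finally show "R ^ r / (1 - R\<^sup>2) \<le> (1 - R) / (M ^ (s + N - 1) * (M\<^sup>2 - 1))" .
  \<comment> \<open>Since R is at least 1/2, the bound for upper vertices is the smaller of the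
    two.\<close>
  have "(1 - R) * M\<^sup>2 \<le> 1 / 2 * M\<^sup>2" using R by (intro mult_right_mono) auto
  also have "\<dots> \<le> M\<^sup>2 - 1" using M2 by simp
  finally have "(1 - R) / (M\<^sup>2 - 1) \<le> 1 / M\<^sup>2" using M M2 by (simp add: divide_simps)
  then have "(1 - R) / (M\<^sup>2 - 1) / M ^ (s + N - 1) \<le> 1 / M\<^sup>2 / M ^ (s + N - 1)"
    using M by (intro divide_right_mono) auto
  then show "(1 - R) / (M ^ (s + N - 1) * (M\<^sup>2 - 1)) \<le> 1 / M ^ (s + N - 1 + 2)"
    by (simp add: power_add power2_eq_square mult_ac)
qed

theorem theorem6p5:
  fixes \<alpha> R e f :: real
    and a am ap :: "nat \<Rightarrow> int"
    and M L :: int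
    and N r s :: nat
    and K :: "nat \<Rightarrow> nat"
  assumes "0 < \<alpha>" and "\<alpha> < 1" and "\<alpha> \<notin> \<rat>"
    and "a = ncf_digit \<alpha>"
    and "bdd_above (a ` {1..})" and "M = (SUP i\<in>{1..}. a i)"
    and "bdd_above (two_block_lengths a)"
    and "N \<ge> 1" and "N - 1 = Sup (two_block_lengths a)"
    and "R = real N / (real N + 1)"
    and "R powi L \<le> (1 - R) * (1 - R\<^sup>2) / (of_int M ^ N * ((of_int M)\<^sup>2 - 1))"
    and "\<And>l::int. R powi l \<le> (1 - R) * (1 - R\<^sup>2) / (of_int M ^ N * ((of_int M)\<^sup>2 - 1)) \<Longrightarrow> L \<le> l"
    and "strict_mono K"
    and "filterlim (\<lambda>i. K (Suc i) - K i) at_top sequentially"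
    and "\<And>j. j \<ge> 1 \<Longrightarrow> (\<lambda>i. a (K i - j + 1)) \<longlonglongrightarrow> am j"
    and "\<And>j. j \<ge> 1 \<Longrightarrow> (\<lambda>i. a (K i + j)) \<longlonglongrightarrow> ap j"
    and "r > 0" and "s > 0" and "s \<ge> N" and "int r \<ge> int s * L"
    and "e \<in> E_set (ncf_value am 1) s"
    and "f \<in> F_set (ncf_value ap (r + 1)) s"
  shows "\<exists>\<beta>. 0 < \<beta> \<and> \<beta> < 1 \<and>
    M_plus \<alpha> \<beta> =
      ereal (e * f * (\<Prod>j=1..r. ncf_value ap j) / (1 - ncf_value am 1 * ncf_value ap 1))"
proof -
  have rem: "0 < ncf_rem \<alpha> i" "ncf_rem \<alpha> i < 1" for i
    using ncf_rem_irrational assms(1-3) by blast+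
  interpret A: bounded_ncf a M N
  proof
    fix j :: nat assume j: "1 \<le> j"
    show "2 \<le> a j" unfolding assms(4) using rem by (rule ncf_digit_ge_2)
    show "a j \<le> M" unfolding assms(6) using assms(5) j by (intro cSUP_upper) auto
    show "\<exists>i<N. 3 \<le> a (j + i)"
    proof (rule ccontr)
      assume "\<not> ?thesis"
      moreover have "2 \<le> a (j + i)" for i unfolding assms(4) using rem by (rule ncf_digit_ge_2)
      ultimately have "\<forall>i<N. a (j + i) = 2" by (metis not_less order_antisym zle_add1_eq_le numeral_plus_one semiring_norm(5))
      \<comment> \<open>N consecutive digits 2 would exceed the supremum N - 1 of the block
        lengths.\<close>
      then have "N \<in> two_block_lengths a" unfolding two_block_lengths_def using j by auto
      then have "N \<le> Sup (two_block_lengths a)" using assms(7) by (intro cSup_upper)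
      then show False using assms(8,9) by simp
    qed
  qed
  have R: "A.R = R" unfolding A.R_def assms(10) ..
  have \<alpha>: "ncf_value a 1 = \<alpha>"
    using ncf_rem_eq_value[of \<alpha> M N 1] A.bounded_ncf_axioms assms(1-4) by simp
  have K_top: "filterlim K at_top sequentially" using assms(13) by (rule filterlim_subseq)
  have left: "\<forall>\<^sub>F i in sequentially. \<forall>j\<in>{1..n}. a (K i + 1 - j) = am j" for n
  proof (rule eventually_ball_finite)
    show "\<forall>j\<in>{1..n}. \<forall>\<^sub>F i in sequentially. a (K i + 1 - j) = am j"
    proof
      fix j assume "j \<in> {1..n}"
      \<comment> \<open>A convergent sequence of integers is eventually constant.\<close>
      then have "\<forall>\<^sub>F i in sequentially. a (K i - j + 1) = am j"
        using assms(15)[of j] by (simp add: tendsto_discrete)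
      \<comment> \<open>With natural subtraction, \<open>K i - j + 1\<close> and
        \<open>K i + 1 - j\<close> agree only once \<open>j \<le> K i\<close>.\<close>
      moreover have "\<forall>\<^sub>F i in sequentially. j \<le> K i" using K_top by (simp add: filterlim_at_top)
      ultimately show "\<forall>\<^sub>F i in sequentially. a (K i + 1 - j) = am j"
        by eventually_elim (simp add: Suc_diff_le)
    qed
  qed simp
  have right: "\<forall>\<^sub>F i in sequentially. \<forall>j\<in>{1..n}. a (K i + j) = ap j" for n
    using assms(16) by (intro eventually_ball_finite) (auto simp: tendsto_discrete)
  have windows: "\<exists>p>B. (\<forall>j\<in>{1..n}. a (p + 1 - j) = am j) \<and> (\<forall>j\<in>{1..m}. a (p + j) = ap j)" for B n m
  proof -
    have "\<forall>\<^sub>F i in sequentially. Suc B \<le> K i" using K_top by (simp add: filterlim_at_top)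
    with left[of n] right[of m] have "\<forall>\<^sub>F i in sequentially. Suc B \<le> K i \<and>
        (\<forall>j\<in>{1..n}. a (K i + 1 - j) = am j) \<and> (\<forall>j\<in>{1..m}. a (K i + j) = ap j)"
      by eventually_elim blast
    then obtain i where "Suc B \<le> K i \<and>
        (\<forall>j\<in>{1..n}. a (K i + 1 - j) = am j) \<and> (\<forall>j\<in>{1..m}. a (K i + j) = ap j)"
      by (auto simp: eventually_sequentially)
    then show ?thesis by (intro exI[of _ "K i"]) auto
  qed
  interpret Y: bounded_ncf am M N
    using windows less_imp_le by (intro A.reversed_windows) blast
  interpret Z: bounded_ncf ap M N
    using windows by (intro A.forward_windows) blast
  interpret Zr: bounded_ncf "\<lambda>i. ap (i + r)" M N by (rule Z.shift)

  obtain c where c: "admissible am c" "(\<lambda>k. of_int (c (Suc k)) * Y.D (Suc k)) sums e"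
    "\<And>i::nat. 1 \<le> i \<Longrightarrow> \<exists>j\<le>s. c (i + j) \<noteq> 0"
    "\<And>i::nat. 1 \<le> i \<Longrightarrow> c (i + s) = am (i + s) - 1 \<Longrightarrow> \<exists>j<s. c (i + j) \<noteq> am (i + j) - 2"
    using assms(21) by (rule Y.E_setE) blast
  have "f \<in> F_set (Zr.v 1) s" using assms(22) by (simp add: ncf_value_shift add.commute)
  then obtain d where d: "admissible (\<lambda>i. ap (i + r)) d" "(\<lambda>k. of_int (d (Suc k)) * Zr.D (Suc k)) sums f"
    "\<And>i::nat. 1 \<le> i \<Longrightarrow> \<exists>j\<le>s. d (i + j) \<noteq> 0"
    "\<And>i::nat. 1 \<le> i \<Longrightarrow> d i = ap (i + r) - 1 \<Longrightarrow> \<exists>j\<in>{1..s}. d (i + j) \<noteq> ap (i + j + r) - 2"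
    by (rule Zr.F_setE) blast
  \<comment> \<open>Neither digit sequence has long zero runs, so both can be cut at nonzero digits
    arbitrarily far out.\<close>
  have "\<exists>m>i. c m \<noteq> 0" "\<exists>m>i. d m \<noteq> 0" for i
  proof -
    obtain j j' where "c (Suc i + j) \<noteq> 0" "d (Suc i + j') \<noteq> 0" using c(3)[of "Suc i"] d(3)[of "Suc i"] by auto
    then show "\<exists>m>i. c m \<noteq> 0" "\<exists>m>i. d m \<noteq> 0"
      by (intro exI[of _ "Suc i + j"], simp, intro exI[of _ "Suc i + j'"], simp)
  qed
  then obtain u w where u: "\<And>i. i < u i \<and> c (u i) \<noteq> 0" and w: "\<And>i. i < w i \<and> d (w i) \<noteq> 0" by metis
  define good where "good n p \<longleftrightarrow> u n \<le> p \<and> (\<forall>j\<in>{1..u n}. a (p + 1 - j) = am j) \<and>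
    (\<forall>j\<in>{1..r + w n}. a (p + j) = ap j)" for n p
  have ex_good: "\<exists>p>B. good n p" for B n
    using windows[of "max B (u n)" "u n" "r + w n"] unfolding good_def by auto
  \<comment> \<open>Dependent choice: each block must start beyond a bound that depends on the
    previous position.\<close>
  have "\<exists>\<kappa>. \<forall>n. good n (\<kappa> n) \<and> \<kappa> n + r + w n + N + u (Suc n) < \<kappa> (Suc n)"
  proof (rule dependent_nat_choice)
    show "\<exists>p. good 0 p" using ex_good by blast
    show "\<exists>p'. good (Suc n) p' \<and> p + r + w n + N + u (Suc n) < p'" for p n using ex_good by blast
  qed
  then obtain \<kappa> where \<kappa>: "\<And>n. good n (\<kappa> n)" "\<And>n. \<kappa> n + r + w n + N + u (Suc n) < \<kappa> (Suc n)" by blast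

  have R_bounds: "1 / 2 \<le> R" "R < 1" using A.R_bounds R by auto
  have M: "3 \<le> real_of_int M" using A.M_ge by simp
  note small = zero_block_small[OF R_bounds M assms(8,18,11,20)]
  have "N \<le> r" using small(1) assms(19) by simp
  interpret B: block_limits a M N am ap c d r s \<kappa> u w e f
  proof unfold_locales
    fix i j :: nat
    show "1 \<le> j \<Longrightarrow> j \<le> u i \<Longrightarrow> a (\<kappa> i + 1 - j) = am j" using \<kappa>(1)[of i] by (simp add: good_def)
    show "1 \<le> j \<Longrightarrow> j \<le> r + w i \<Longrightarrow> a (\<kappa> i + j) = ap j" using \<kappa>(1)[of i] by (simp add: good_def)
    show "u 0 \<le> \<kappa> 0" using \<kappa>(1)[of 0] by (simp add: good_def)
    show "(\<lambda>k. real_of_int (d (Suc k)) * (\<Prod>i<Suc k. ncf_value ap (Suc (r + i)))) sums f"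
      using d(2) by (simp add: Zr.D_def ncf_value_shift add.commute del: prod.lessThan_Suc)
  qed (use c d u w \<kappa> assms(19) \<open>N \<le> r\<close> Y.digit_ge Y.digit_le Y.no_twos Z.digit_ge Z.digit_le Z.no_twos in blast)+

  define V where "V = e * f * (\<Prod>j=1..r. ncf_value ap j) / (1 - ncf_value am 1 * ncf_value ap 1)"
  have ef: "0 \<le> e" "e \<le> 1" "0 \<le> f" "f \<le> 1" using assms(21,22) by (auto simp: E_set_def F_set_def)
  have prod: "0 \<le> (\<Prod>j=1..r. ncf_value ap j)" "(\<Prod>j=1..r. ncf_value ap j) \<le> R ^ r"
  proof -
    show "0 \<le> (\<Prod>j=1..r. ncf_value ap j)" using Z.v_range by (intro prod_nonneg) auto
    have "(\<Prod>j=1..r. ncf_value ap j) \<le> (\<Prod>j=1..r. A.R)" using Z.v_range by (intro prod_mono) auto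
    then show "(\<Prod>j=1..r. ncf_value ap j) \<le> R ^ r" by (simp add: R)
  qed
  have den: "0 < 1 - R\<^sup>2" "1 - R\<^sup>2 \<le> 1 - ncf_value am 1 * ncf_value ap 1"
  proof -
    show "0 < 1 - R\<^sup>2" using R_bounds power_less_one_iff[of R 2] by simp
    have "ncf_value am 1 * ncf_value ap 1 \<le> A.R * A.R"
      using Y.v_range[of 1] Z.v_range[of 1] A.R_bounds by (intro mult_mono) auto
    then show "1 - R\<^sup>2 \<le> 1 - ncf_value am 1 * ncf_value ap 1" by (simp add: R power2_eq_square)
  qed
  \<comment> \<open>Here e and f are at most 1 and every tail is at most R, so V is at most
    \<open>R ^ r / (1 - R\<^sup>2)\<close>, which \<open>zero_block_small\<close> controls.\<close>
  have "e * f * (\<Prod>j=1..r. ncf_value ap j) \<le> 1 * 1 * R ^ r"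
    using ef prod by (intro mult_mono) auto
  then have "V \<le> R ^ r / (1 - R\<^sup>2)"
    unfolding V_def using ef prod den R_bounds by (intro frac_le) auto
  then have V: "0 \<le> V" "V \<le> (1 - A.R) / (of_int M ^ (s + N - 1) * ((of_int M)\<^sup>2 - 1))"
    "V \<le> 1 / of_int M ^ (s + N - 1 + 2)"
    using small ef prod den unfolding R by (auto simp: V_def)
  have "M_plus \<alpha> (B.T 0) = ereal V" using B.M_plus_eq[OF V_def V] by (simp only: \<alpha>)
  moreover have "0 < B.T 0" "B.T 0 < 1" using B.T_pos[of 0] B.T_less_D[of 0] by auto
  ultimately show ?thesis unfolding V_def by blast
qed

end
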